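(* Let $(A,\mathcal N)$ be a *local Noetherian graded ring such that $A-\mathcal N$ contains a homogeneous element of degree $1$, let $M$ be a finitely generated graded $A$-module, and let $\mathcal I$ be a graded ideal of definition for $M$. Then $\ell_{A_0}(M_0/(\mathcal I_0)^nM_0)<\infty$ for every $n$, ${}^*p(M,\mathcal I,n)=p(M_0,\mathcal I_0,n)$, and for every $d$ (for which these multiplicities are defined), $e(M_0,\mathcal I_0,d)={}^*e(M,\mathcal I,d)$.
   Context: All rings are commutative; "graded" means $\mathbb Z$-graded. The subscript $0$ denotes the degree-zero part: $A_0$ is a ring, $M_0$ an $A_0$-module, $\mathcal I_0=\mathcal I\cap A_0$. A graded ideal is *maximal if it is maximal among proper graded ideals; $A$ is *local if it has exactly one *maximal ideal, denoted $\mathcal N$. ${}^*\ell_A(M)$ is the length $n$ of a chain $0=M^0\subset\cdots\subset M^n=M$ of graded submodules whose successive quotients are *simple (nonzero with no nonzero proper graded submodule); it is independent of the chain, and is $\infty$ if no such chain exists. $\ell_{A_0}$ is ordinary length. A graded ideal of definition for $M$ is a proper graded ideal $\mathcal I$ of $A$ with ${}^*\ell_A(M/\mathcal IM)<\infty$. Then ${}^*p(M,\mathcal I,n)$ is the unique polynomial in $\mathbb Q[n]$ equal to ${}^*\ell_A(M/\mathcal I^nM)$ for $n\gg0$. The polynomial $p(M_0,\mathcal I_0,n)$ is the ordinary Samuel polynomial: the unique polynomial equal to $\ell_{A_0}(M_0/(\mathcal I_0)^nM_0)$ for $n\gg0$. With $\Delta f(n)=f(n+1)-f(n)$, ${}^*e(M,\mathcal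 I,d)=\Delta^d({}^*p(M,\mathcal I,n))$ and $e(M_0,\mathcal I_0,d)=\Delta^d(p(M_0,\mathcal I_0,n))$ for integers $d\ge0$ not less than the degree of the polynomial in question. *)

theory Defs
  imports
    "HOL-Algebra.Ideal_Product"
    "HOL-Algebra.Ring_Divisibility"
    "HOL-Algebra.Module"
    "HOL-Computational_Algebra.Polynomial"
    "HOL-Library.Extended_Nat"
begin

section \<open>Gradings\<close>

definition hom_decomp ::
  "('a, 'x) ring_scheme \<Rightarrow> (int \<Rightarrow> 'a set) \<Rightarrow> 'a \<Rightarrow> (int \<Rightarrow> 'a) \<Rightarrow> bool" where
  "hom_decomp G gr x f \<longleftrightarrow>
     (\<forall>i. f i \<in> gr i) \<and> finite {i. f i \<noteq> \<zero>\<^bsub>G\<^esub>} \<and>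
     x = finsum G f {i. f i \<noteq> \<zero>\<^bsub>G\<^esub>}"

text \<open>The additive group of \<open>G\<close> is the internal direct sum of the subgroups \<open>gr i\<close>.\<close>

definition grading :: "('a, 'x) ring_scheme \<Rightarrow> (int \<Rightarrow> 'a set) \<Rightarrow> bool" where
  "grading G gr \<longleftrightarrow>
     (\<forall>i. additive_subgroup (gr i) G) \<and> (\<forall>x \<in> carrier G. \<exists>!f. hom_decomp G gr x f)"

text \<open>Degree-zero membership of the unit is not assumed: it follows from the axioms.\<close>

locale graded_ring = cring A for A :: "('a, 'x) ring_scheme" (structure) +
  fixes gA :: "int \<Rightarrow> 'a set"
  assumes ring_grading: "grading A gA"
    and ring_grading_mult: "\<lbrakk>a \<in> gA i; b \<in> gA j\<rbrakk> \<Longrightarrow> a \<otimes> b \<in> gA (i + j)"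

locale graded_module = graded_ring A gA + module A M
  for A :: "('a, 'x) ring_scheme" (structure) and gA
    and M :: "('a, 'b, 'y) module_scheme" (structure) +
  fixes gM :: "int \<Rightarrow> 'b set"
  assumes module_grading: "grading M gM"
    and module_grading_smult: "\<lbrakk>a \<in> gA i; m \<in> gM j\<rbrakk> \<Longrightarrow> a \<odot>\<^bsub>M\<^esub> m \<in> gM (i + j)"

definition graded_ideal :: "('a, 'x) ring_scheme \<Rightarrow> (int \<Rightarrow> 'a set) \<Rightarrow> 'a set \<Rightarrow> bool" where
  "graded_ideal A gA I \<longleftrightarrow>
     ideal I A \<and> (\<forall>x \<in> I. \<exists>f. hom_decomp A (\<lambda>i. gA i \<inter> I) x f)"

definition graded_submodule ::
  "('a, 'x) ring_scheme \<Rightarrow> ('a, 'b, 'y) module_scheme \<Rightarrow> (int \<Rightarrow> 'b set) \<Rightarrow> 'b set \<Rightarrow> bool" where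
  "graded_submodule A M gM N \<longleftrightarrow>
     submodule N A M \<and> (\<forall>x \<in> N. \<exists>f. hom_decomp M (\<lambda>i. gM i \<inter> N) x f)"

definition star_maximal :: "('a, 'x) ring_scheme \<Rightarrow> (int \<Rightarrow> 'a set) \<Rightarrow> 'a set \<Rightarrow> bool" where
  "star_maximal A gA P \<longleftrightarrow>
     graded_ideal A gA P \<and> P \<noteq> carrier A \<and>
     (\<forall>J. graded_ideal A gA J \<and> J \<noteq> carrier A \<and> P \<subseteq> J \<longrightarrow> J = P)"

definition star_local :: "('a, 'x) ring_scheme \<Rightarrow> (int \<Rightarrow> 'a set) \<Rightarrow> 'a set \<Rightarrow> bool" where
  "star_local A gA P \<longleftrightarrow> star_maximal A gA P \<and> (\<forall>Q. star_maximal A gA Q \<longrightarrow> Q = P)"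

section \<open>Module constructions\<close>

definition fin_gen_module :: "('a, 'x) ring_scheme \<Rightarrow> ('a, 'b, 'y) module_scheme \<Rightarrow> bool" where
  "fin_gen_module R M \<longleftrightarrow>
     (\<exists>S. finite S \<and> S \<subseteq> carrier M \<and>
        (\<forall>x \<in> carrier M. \<exists>c \<in> S \<rightarrow> carrier R. x = (\<Oplus>\<^bsub>M\<^esub>s\<in>S. c s \<odot>\<^bsub>M\<^esub> s)))"

text \<open>\<open>I M\<close>, the set of finite sums of products, in analogy with \<^const>\<open>ideal_prod\<close>.\<close>

inductive_set ideal_smult :: "('a, 'b, 'y) module_scheme \<Rightarrow> 'a set \<Rightarrow> 'b set"
  for M and I where
    prod: "\<lbrakk>a \<in> I; m \<in> carrier M\<rbrakk> \<Longrightarrow> a \<odot>\<^bsub>M\<^esub> m \<in> ideal_smult M I"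
  | sum: "\<lbrakk>x \<in> ideal_smult M I; y \<in> ideal_smult M I\<rbrakk> \<Longrightarrow> x \<oplus>\<^bsub>M\<^esub> y \<in> ideal_smult M I"

text \<open>
  The fields \<^const>\<open>monoid.mult\<close> and \<^const>\<open>one\<close> of a module record play no role in the theory of
  modules, so they are left unspecified.
\<close>

definition quot_module :: "('a, 'b, 'y) module_scheme \<Rightarrow> 'b set \<Rightarrow> ('a, 'b set) module" where
  "quot_module M N =
     \<lparr>carrier = a_rcosets\<^bsub>M\<^esub> N, monoid.mult = undefined, one = undefined,
      zero = N, add = set_add M,
      module.smult = (\<lambda>a X. \<Union>x\<in>X. N +>\<^bsub>M\<^esub> (a \<odot>\<^bsub>M\<^esub> x))\<rparr>"

definition quot_grading ::
  "('a, 'b, 'y) module_scheme \<Rightarrow> (int \<Rightarrow> 'b set) \<Rightarrow> 'b set \<Rightarrow> int \<Rightarrow> 'b set set" where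
  "quot_grading M gM N i = (\<lambda>x. N +>\<^bsub>M\<^esub> x) ` gM i"

section \<open>Length\<close>

definition simple_module :: "('a, 'x) ring_scheme \<Rightarrow> ('a, 'b, 'y) module_scheme \<Rightarrow> bool" where
  "simple_module R M \<longleftrightarrow>
     carrier M \<noteq> {\<zero>\<^bsub>M\<^esub>} \<and> (\<forall>N. submodule N R M \<longrightarrow> N = {\<zero>\<^bsub>M\<^esub>} \<or> N = carrier M)"

definition star_simple ::
  "('a, 'x) ring_scheme \<Rightarrow> ('a, 'b, 'y) module_scheme \<Rightarrow> (int \<Rightarrow> 'b set) \<Rightarrow> bool" where
  "star_simple A M gM \<longleftrightarrow>
     carrier M \<noteq> {\<zero>\<^bsub>M\<^esub>} \<and>
     (\<forall>N. graded_submodule A M gM N \<longrightarrow> N = {\<zero>\<^bsub>M\<^esub>} \<or> N = carrier M)"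

definition comp_series ::
  "('a, 'x) ring_scheme \<Rightarrow> ('a, 'b, 'y) module_scheme \<Rightarrow> (nat \<Rightarrow> 'b set) \<Rightarrow> nat \<Rightarrow> bool" where
  "comp_series R M C n \<longleftrightarrow>
     C 0 = {\<zero>\<^bsub>M\<^esub>} \<and> C n = carrier M \<and>
     (\<forall>i\<le>n. submodule (C i) R M) \<and>
     (\<forall>i<n. C i \<subset> C (Suc i) \<and>
        simple_module R (quot_module (M\<lparr>carrier := C (Suc i)\<rparr>) (C i)))"

definition star_comp_series ::
  "('a, 'x) ring_scheme \<Rightarrow> ('a, 'b, 'y) module_scheme \<Rightarrow> (int \<Rightarrow> 'b set) \<Rightarrow>
   (nat \<Rightarrow> 'b set) \<Rightarrow> nat \<Rightarrow> bool" where
  "star_comp_series A M gM C n \<longleftrightarrow>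
     C 0 = {\<zero>\<^bsub>M\<^esub>} \<and> C n = carrier M \<and>
     (\<forall>i\<le>n. graded_submodule A M gM (C i)) \<and>
     (\<forall>i<n. C i \<subset> C (Suc i) \<and>
        star_simple A (quot_module (M\<lparr>carrier := C (Suc i)\<rparr>) (C i))
          (quot_grading (M\<lparr>carrier := C (Suc i)\<rparr>) (\<lambda>j. gM j \<inter> C (Suc i)) (C i)))"

text \<open>
  All composition series of a module have the same length, so \<open>LEAST\<close> merely selects that
  common value.
\<close>

definition mod_length :: "('a, 'x) ring_scheme \<Rightarrow> ('a, 'b, 'y) module_scheme \<Rightarrow> enat" where
  "mod_length R M =
     (if \<exists>n C. comp_series R M C n then enat (LEAST n. \<exists>C. comp_series R M C n) else \<infinity>)"

definition star_length ::
  "('a, 'x) ring_scheme \<Rightarrow> ('a, 'b, 'y) module_scheme \<Rightarrow> (int \<Rightarrow> 'b set) \<Rightarrow> enat" where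
  "star_length A M gM =
     (if \<exists>n C. star_comp_series A M gM C n
      then enat (LEAST n. \<exists>C. star_comp_series A M gM C n) else \<infinity>)"

section \<open>Samuel polynomials and multiplicities\<close>

definition graded_ideal_of_definition ::
  "('a, 'x) ring_scheme \<Rightarrow> (int \<Rightarrow> 'a set) \<Rightarrow> ('a, 'b, 'y) module_scheme \<Rightarrow>
   (int \<Rightarrow> 'b set) \<Rightarrow> 'a set \<Rightarrow> bool" where
  "graded_ideal_of_definition A gA M gM I \<longleftrightarrow>
     graded_ideal A gA I \<and> I \<noteq> carrier A \<and>
     star_length A (quot_module M (ideal_smult M I)) (quot_grading M gM (ideal_smult M I)) < \<infinity>"

definition eventually_poly :: "(nat \<Rightarrow> enat) \<Rightarrow> rat poly \<Rightarrow> bool" where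
  "eventually_poly f p \<longleftrightarrow>
     (\<exists>n0. \<forall>n\<ge>n0. \<exists>k. f n = enat k \<and> poly p (of_nat n) = of_nat k)"

definition the_poly :: "(nat \<Rightarrow> enat) \<Rightarrow> rat poly" where
  "the_poly f = (THE p. eventually_poly f p)"

lemma eventually_poly_unique:
  assumes "eventually_poly f p" "eventually_poly f q"
  shows "p = q"
proof -
  obtain n1 where n1: "\<forall>n\<ge>n1. \<exists>k. f n = enat k \<and> poly p (of_nat n) = of_nat k"
    using assms(1) unfolding eventually_poly_def by blast
  obtain n2 where n2: "\<forall>n\<ge>n2. \<exists>k. f n = enat k \<and> poly q (of_nat n) = of_nat k"
    using assms(2) unfolding eventually_poly_def by blast
  have eq: "poly (p - q) (of_nat n) = 0" if "n \<ge> max n1 n2" for n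
    using n1[rule_format, of n] n2[rule_format, of n] that by auto
  have "infinite ((of_nat :: nat \<Rightarrow> rat) ` {max n1 n2..})"
    by (metis finite_imageD infinite_Ici inj_of_nat inj_on_subset subset_UNIV)
  moreover have "(of_nat :: nat \<Rightarrow> rat) ` {max n1 n2..} \<subseteq> {x. poly (p - q) x = 0}"
    using eq by blast
  ultimately have "infinite {x. poly (p - q) x = 0}"
    by (rule infinite_super[rotated])
  then have "p - q = 0"
    using poly_roots_finite by blast
  then show ?thesis by simp
qed

lemma the_poly_eq: "eventually_poly f p \<Longrightarrow> the_poly f = p"
  unfolding the_poly_def using eventually_poly_unique by blast

definition samuel_poly ::
  "('a, 'x) ring_scheme \<Rightarrow> ('a, 'b, 'y) module_scheme \<Rightarrow> 'a set \<Rightarrow> rat poly" where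
  "samuel_poly R M I =
     the_poly (\<lambda>n. mod_length R (quot_module M (ideal_smult M (I [^]\<^bsub>ideals_set R\<^esub> n))))"

definition star_samuel_poly ::
  "('a, 'x) ring_scheme \<Rightarrow> ('a, 'b, 'y) module_scheme \<Rightarrow> (int \<Rightarrow> 'b set) \<Rightarrow> 'a set \<Rightarrow> rat poly" where
  "star_samuel_poly A M gM I =
     the_poly (\<lambda>n. star_length A
       (quot_module M (ideal_smult M (I [^]\<^bsub>ideals_set A\<^esub> n)))
       (quot_grading M gM (ideal_smult M (I [^]\<^bsub>ideals_set A\<^esub> n))))"

definition fwd_diff :: "rat poly \<Rightarrow> rat poly" where
  "fwd_diff p = pcompose p [:1, 1:] - p"

lemma poly_fwd_diff: "poly (fwd_diff p) x = poly p (x + 1) - poly p x"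
  by (simp add: fwd_diff_def poly_pcompose add.commute)

text \<open>
  The multiplicities are defined only for \<open>d\<close> at least the degree of the polynomial; the
  value is then a constant polynomial.
\<close>

definition multiplicity_at ::
  "('a, 'x) ring_scheme \<Rightarrow> ('a, 'b, 'y) module_scheme \<Rightarrow> 'a set \<Rightarrow> nat \<Rightarrow> rat poly" where
  "multiplicity_at R M I d = (fwd_diff ^^ d) (samuel_poly R M I)"

definition star_multiplicity_at ::
  "('a, 'x) ring_scheme \<Rightarrow> ('a, 'b, 'y) module_scheme \<Rightarrow> (int \<Rightarrow> 'b set) \<Rightarrow> 'a set \<Rightarrow> nat \<Rightarrow>
   rat poly" where
  "star_multiplicity_at A M gM I d = (fwd_diff ^^ d) (star_samuel_poly A M gM I)"

section \<open>Degree-zero parts\<close>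

definition deg0_ring :: "('a, 'x) ring_scheme \<Rightarrow> (int \<Rightarrow> 'a set) \<Rightarrow> ('a, 'x) ring_scheme" where
  "deg0_ring A gA = A\<lparr>carrier := gA 0\<rparr>"

definition deg0_module ::
  "('a, 'b, 'y) module_scheme \<Rightarrow> (int \<Rightarrow> 'b set) \<Rightarrow> ('a, 'b, 'y) module_scheme" where
  "deg0_module M gM = M\<lparr>carrier := gM 0\<rparr>"

end

theory Submission
  imports Defs "HOL-Algebra.Subrings"
begin

text \<open>
  A homogeneous element \<open>t\<close> of degree one outside the unique *maximal ideal generates a graded ideal
  contained in no *maximal ideal, so it is a unit. Multiplication by powers of \<open>t\<close> identifies
  all graded pieces of \<open>M\<close> with \<open>M\<^sub>0\<close>; hence \<open>N \<mapsto> N \<inter> M\<^sub>0\<close> is an isomorphism from the lattice of graded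
  submodules of \<open>M\<close> to the lattice of \<open>A\<^sub>0\<close>-submodules of \<open>M\<^sub>0\<close>, and it sends \<open>I\<^sup>n M\<close> to
  \<open>I\<^sub>0\<^sup>n M\<^sub>0\<close>. Lengths of quotients only depend on intervals of these lattices, so the two length
  functions agree for every \<open>n\<close>, not only asymptotically. Finiteness for all \<open>n\<close> follows from the case
  \<open>n = 1\<close> because \<open>I\<^sub>0\<^sup>n\<close> is finitely generated over the Noetherian ring \<open>A\<^sub>0\<close>.
\<close>

section \<open>Sums of homogeneous elements\<close>

text \<open>Both lengths speak of composition series of coset modules, while the comparison concerns
  submodules of one fixed module. They are therefore rewritten as lengths of saturated chains in the
  interval from \<open>N\<close> to the whole module, a form that every order isomorphism of
  intervals preserves. A decomposition indexed by degrees with finite support is awkward in proofs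
  that build an element summand by summand; \<open>hsum\<close> generates the same elements by
  adding one homogeneous element at a time, so that such proofs become rule inductions. The transfer
  to degree zero settles finiteness only for I_0 itself. For higher powers, I_0^k M_0 is reached
  from I_0^(k+1) M_0 by adding a M_0 for the finitely many generators a of I_0^k in turn. Since a
  I_0 M_0 lies in I_0^(k+1) M_0, each addition contributes a quotient of M_0 / I_0 M_0, hence
  something of finite length.\<close>

inductive_set hsum :: "('a, 'x) ring_scheme \<Rightarrow> (int \<Rightarrow> 'a set) \<Rightarrow> 'a set"
  for G and gr where
    zero: "\<zero>\<^bsub>G\<^esub> \<in> hsum G gr"
  | add: "\<lbrakk>x \<in> gr i; y \<in> hsum G gr\<rbrakk> \<Longrightarrow> x \<oplus>\<^bsub>G\<^esub> y \<in> hsum G gr"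

lemma hsum_mono:
  assumes "\<And>i. gr i \<subseteq> gr' i"
  shows "hsum G gr \<subseteq> hsum G gr'"
proof
  fix x assume "x \<in> hsum G gr" then show "x \<in> hsum G gr'"
    by induction (use assms in \<open>auto intro: hsum.intros\<close>)
qed

lemma hsum_carrier_update [simp]: "hsum (M\<lparr>carrier := K\<rparr>) gr = hsum M gr"
proof
  show "hsum (M\<lparr>carrier := K\<rparr>) gr \<subseteq> hsum M gr"
  proof
    fix x assume "x \<in> hsum (M\<lparr>carrier := K\<rparr>) gr" then show "x \<in> hsum M gr"
      by induction (auto intro: hsum.intros)
  qed
  show "hsum M gr \<subseteq> hsum (M\<lparr>carrier := K\<rparr>) gr"
  proof
    fix x assume "x \<in> hsum M gr" then show "x \<in> hsum (M\<lparr>carrier := K\<rparr>) gr"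
    proof induction
      case zero then show ?case using hsum.zero[of "M\<lparr>carrier := K\<rparr>"] by simp
    next
      case (add x i y) then show ?case using hsum.add[of x gr i y "M\<lparr>carrier := K\<rparr>"] by simp
    qed
  qed
qed

context abelian_group
begin

lemma hsum_subset:
  assumes "additive_subgroup N G" "\<And>i. gr i \<subseteq> N"
  shows "hsum G gr \<subseteq> N"
proof
  interpret additive_subgroup N G by fact
  fix x assume "x \<in> hsum G gr" then show "x \<in> N"
    by induction (use assms(2) in auto)
qed

lemma carrier_additive_subgroup: "additive_subgroup (carrier G) G"
  by (rule additive_subgroupI[OF add.subgroup_self])

lemma hsum_closed:
  assumes "\<And>i. gr i \<subseteq> carrier G" "x \<in> hsum G gr"
  shows "x \<in> carrier G"
  using hsum_subset[of "carrier G" gr, OF carrier_additive_subgroup assms(1)] assms(2) by blast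

lemma hsum_add:
  assumes "\<And>i. gr i \<subseteq> carrier G" "x \<in> hsum G gr" "y \<in> hsum G gr"
  shows "x \<oplus> y \<in> hsum G gr"
  using assms(2)
proof induction
  case zero then show ?case using assms(3) hsum_closed[OF assms(1,3)] by simp
next
  case (add x i z)
  have "x \<oplus> z \<oplus> y = x \<oplus> (z \<oplus> y)"
    using add assms hsum_closed by (meson a_assoc subsetD)
  then show ?case using add by (simp add: hsum.add)
qed

lemma hsum_homogeneous:
  assumes "gr i \<subseteq> carrier G" "x \<in> gr i"
  shows "x \<in> hsum G gr"
  using hsum.add[of x gr i "\<zero>" G] hsum.zero[of G gr] assms by auto

lemma hsum_additive_subgroup:
  assumes "\<And>i. additive_subgroup (gr i) G"
  shows "additive_subgroup (hsum G gr) G"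
proof -
  have sub: "gr i \<subseteq> carrier G" for i using assms additive_subgroup.a_subset by blast
  have "\<ominus> x \<in> hsum G gr" if "x \<in> hsum G gr" for x
    using that
  proof induction
    case zero
    have "\<zero> \<oplus> \<ominus> \<zero> = \<zero>" by (rule r_neg) simp
    then have "\<ominus> \<zero> = \<zero>" by (simp del: r_neg)
    then show ?case using hsum.zero[of G gr] by metis
  next
    case (add x i y)
    have "x \<in> carrier G" "y \<in> carrier G"
      using add(1) sub hsum_closed[OF sub add(2)] by blast+
    then have "\<ominus> (x \<oplus> y) = \<ominus> x \<oplus> \<ominus> y" by (simp add: minus_add)
    moreover have "\<ominus> x \<in> gr i"
      using additive_subgroup.a_inv_closed[OF assms] add(1) by blast
    ultimately show ?case using hsum.add[of "\<ominus> x" gr i "\<ominus> y"] add(3) by simp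
  qed
  moreover have "hsum G gr \<subseteq> carrier G" using hsum_closed[of gr, OF sub] by blast
  moreover have "hsum G gr \<noteq> {}" using hsum.zero[of G gr] by blast
  ultimately show ?thesis
    using hsum_add[of gr, OF sub] by (intro additive_subgroupI add.subgroupI) (simp_all)
qed

text \<open>The support in \<open>hom_decomp\<close> varies with \<open>f\<close>. Summing over any
  finite set containing it adds only zeros, so two decompositions can be compared over a common
  index set.\<close>

lemma hom_decomp_superset:
  assumes "finite F" "\<And>i. f i \<in> gr i" "\<And>i. gr i \<subseteq> carrier G" "\<And>i. i \<notin> F \<Longrightarrow> f i = \<zero>"
  shows "hom_decomp G gr x f \<longleftrightarrow> x = finsum G f F"
proof -
  have sub: "{i. f i \<noteq> \<zero>} \<subseteq> F" using assms(4) by blast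
  then have "finsum G f {i. f i \<noteq> \<zero>} = finsum G f F"
    using assms by (intro add.finprod_mono_neutral_cong_left) blast+
  then show ?thesis
    unfolding hom_decomp_def using sub assms(1,2) finite_subset by auto
qed

lemma hom_decomp_add:
  assumes "\<And>i. additive_subgroup (gr i) G" "hom_decomp G gr x f" "hom_decomp G gr y g"
  shows "hom_decomp G gr (x \<oplus> y) (\<lambda>i. f i \<oplus> g i)"
proof -
  have sub: "gr i \<subseteq> carrier G" for i using assms additive_subgroup.a_subset by blast
  \<comment> \<open>Cancellation can make the support of the sum smaller than this union;
    \<open>hom_decomp_superset\<close> absorbs the difference.\<close>
  let ?F = "{i. f i \<noteq> \<zero>} \<union> {i. g i \<noteq> \<zero>}"
  have fin: "finite ?F" and fg: "\<And>i. f i \<in> gr i" "\<And>i. g i \<in> gr i"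
    using assms(2,3) unfolding hom_decomp_def by auto
  have "x = finsum G f ?F"
    by (rule iffD1[OF hom_decomp_superset[OF fin fg(1) sub] assms(2)]) blast
  moreover have "y = finsum G g ?F"
    by (rule iffD1[OF hom_decomp_superset[OF fin fg(2) sub] assms(3)]) blast
  moreover have "f \<in> ?F \<rightarrow> carrier G" "g \<in> ?F \<rightarrow> carrier G" using fg sub by blast+
  ultimately have "x \<oplus> y = finsum G (\<lambda>i. f i \<oplus> g i) ?F"
    by (simp only: finsum_addf)
  moreover have "f i \<oplus> g i \<in> gr i" for i
    using fg additive_subgroup.a_closed[OF assms(1)] by blast
  ultimately show ?thesis
    by (intro iffD2[OF hom_decomp_superset[OF fin _ sub]]) auto
qed

lemma hom_decomp_homogeneous:
  assumes "\<And>i. additive_subgroup (gr i) G" "x \<in> gr j"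
  shows "hom_decomp G gr x (\<lambda>i. if i = j then x else \<zero>)"
proof -
  have sub: "gr i \<subseteq> carrier G" for i using assms additive_subgroup.a_subset by blast
  have "x \<in> carrier G" using assms(2) sub by blast
  then have "finsum G (\<lambda>i. if i = j then x else \<zero>) {j} = x" by simp
  moreover have "(if i = j then x else \<zero>) \<in> gr i" for i
    using assms additive_subgroup.zero_closed by auto
  ultimately show ?thesis
    by (intro iffD2[OF hom_decomp_superset[of "{j}", OF _ _ sub]]) auto
qed

text \<open>A homogeneous element has a one-term decomposition and decompositions add, which gives
  one direction; conversely the finite sum over the support is assembled term by term.\<close>

lemma hsum_iff_hom_decomp:
  assumes gr: "\<And>i. additive_subgroup (gr i) G"
  shows "x \<in> hsum G gr \<longleftrightarrow> (\<exists>f. hom_decomp G gr x f)"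
proof
  assume "x \<in> hsum G gr" then show "\<exists>f. hom_decomp G gr x f"
  proof induction
    case zero
    have "\<zero> \<in> gr 0" using gr additive_subgroup.zero_closed by blast
    then show ?case using hom_decomp_homogeneous[of gr, OF gr] by blast
  next
    case (add x i y)
    then show ?case
      using hom_decomp_homogeneous[of gr, OF gr] hom_decomp_add[of gr, OF gr] by blast
  qed
next
  have sub: "gr i \<subseteq> carrier G" for i using assms additive_subgroup.a_subset by blast
  \<comment> \<open>The support is generalised to an arbitrary finite \<open>F\<close>, since the
    support of a fixed \<open>f\<close> cannot shrink during the induction.\<close>
  have sums: "finsum G f F \<in> hsum G gr"
    if "finite F" "f \<in> F \<rightarrow> carrier G" "\<And>i. f i \<in> gr i" for f F
    using that
  proof induction
    case empty show ?case by (simp add: hsum.zero)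
  next
    case (insert i F)
    then show ?case using hsum.add[of "f i" gr i] by simp
  qed
  assume "\<exists>f. hom_decomp G gr x f"
  then obtain f where f: "\<And>i. f i \<in> gr i" "finite {i. f i \<noteq> \<zero>}"
    "x = finsum G f {i. f i \<noteq> \<zero>}"
    unfolding hom_decomp_def by blast
  have "f \<in> {i. f i \<noteq> \<zero>} \<rightarrow> carrier G" using f(1) sub by blast
  then show "x \<in> hsum G gr" unfolding f(3) using sums f(1,2) by blast
qed

end

text \<open>
  Uniqueness of homogeneous decompositions is not required here, so the constant family
  \<open>\<lambda>_. carrier M\<close> is allowed; it makes ordinary length a special case of *length.
\<close>

locale pregraded_module = module R M
  for R :: "('a, 'x) ring_scheme" (structure) and M :: "('a, 'b, 'y) module_scheme" (structure) +
  fixes gr :: "int \<Rightarrow> 'b set"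
  assumes gr_subgroup: "additive_subgroup (gr i) M"
begin

lemma gr_subset: "gr i \<subseteq> carrier M"
  by (rule additive_subgroup.a_subset[OF gr_subgroup])

lemma submodule_additive_subgroup: "submodule N R M \<Longrightarrow> additive_subgroup N M"
  by (rule additive_subgroupI[OF submodule.axioms(1)])

lemma gr_inter_subgroup:
  assumes "submodule N R M"
  shows "additive_subgroup (gr i \<inter> N) M"
  using additive_subgroup.a_subgroup[OF gr_subgroup, of i] submodule.axioms(1)[OF assms]
  by (intro additive_subgroupI M.add.subgroups_Inter_pair)

text \<open>Only one inclusion is demanded: sums of elements of \<open>N\<close> stay in
  \<open>N\<close> because \<open>N\<close> is a subgroup.\<close>

lemma graded_submodule_iff:
  "graded_submodule R M gr N \<longleftrightarrow> submodule N R M \<and> N \<subseteq> hsum M (\<lambda>i. gr i \<inter> N)"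
proof (cases "submodule N R M")
  case True
  then show ?thesis
    using M.hsum_iff_hom_decomp[of "\<lambda>i. gr i \<inter> N", OF gr_inter_subgroup[OF True]]
    unfolding graded_submodule_def by auto
qed (simp add: graded_submodule_def)

end

text \<open>Factors of a composition series are quotients of the record restricted to a member of
  the series. This moves statements about submodules of such a restricted record back to
  \<open>M\<close>.\<close>

lemma (in module) submodule_of_submodule_iff:
  assumes "submodule K R M"
  shows "submodule N R (M\<lparr>carrier := K\<rparr>) \<longleftrightarrow> submodule N R M \<and> N \<subseteq> K"
proof -
  interpret K: module R "M\<lparr>carrier := K\<rparr>" by (rule submodule.submodule_is_module[OF assms module_axioms])
  have "subgroup K (add_monoid M)" using assms submodule.axioms(1) by blast
  then have "subgroup N (add_monoid (M\<lparr>carrier := K\<rparr>)) \<longleftrightarrow> subgroup N (add_monoid M) \<and> N \<subseteq> K"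
    using M.add.incl_subgroup[of K N] M.add.subgroup_incl[of N K]
      subgroup.subset[of N "add_monoid (M\<lparr>carrier := K\<rparr>)"] by auto
  then show ?thesis
    unfolding submodule_def submodule_axioms_def by auto
qed

context pregraded_module
begin

lemma pregraded_submodule:
  assumes "submodule K R M"
  shows "pregraded_module R (M\<lparr>carrier := K\<rparr>) (\<lambda>i. gr i \<inter> K)"
proof -
  interpret K: module R "M\<lparr>carrier := K\<rparr>" by (rule submodule.submodule_is_module[OF assms module_axioms])
  have "subgroup K (add_monoid M)" using assms submodule.axioms(1) by blast
  then have "subgroup (gr i \<inter> K) (add_monoid (M\<lparr>carrier := K\<rparr>))" for i
    using M.add.subgroup_incl[of "gr i \<inter> K" K] gr_inter_subgroup[OF assms, of i]
    by (simp add: additive_subgroup_def)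
  then show ?thesis
    by (intro pregraded_module.intro K.module_axioms pregraded_module_axioms.intro
        additive_subgroupI)
qed

lemma graded_submodule_of_submodule_iff:
  assumes "submodule K R M"
  shows "graded_submodule R (M\<lparr>carrier := K\<rparr>) (\<lambda>i. gr i \<inter> K) N \<longleftrightarrow> graded_submodule R M gr N \<and> N \<subseteq> K"
proof -
  interpret K: pregraded_module R "M\<lparr>carrier := K\<rparr>" "\<lambda>i. gr i \<inter> K"
    by (rule pregraded_submodule[OF assms])
  have "(\<lambda>i. gr i \<inter> K \<inter> N) = (\<lambda>i. gr i \<inter> N)" if "N \<subseteq> K" using that by blast
  then show ?thesis
    unfolding graded_submodule_iff K.graded_submodule_iff
      submodule_of_submodule_iff[OF assms] by auto
qed

end

lemma (in abelian_group_hom) hsum_image: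
  assumes "\<And>i. gr i \<subseteq> carrier G" "\<And>i. h ` gr i \<subseteq> gr' i" "x \<in> hsum G gr"
  shows "h x \<in> hsum H gr'"
  using assms(3)
proof induction
  case zero then show ?case by (simp add: hsum.zero)
next
  case (add x i y)
  have "x \<in> carrier G" "y \<in> carrier G"
    using add(1) assms(1) G.hsum_closed[of gr, OF assms(1) add(2)] by blast+
  moreover have "h x \<in> gr' i" using add(1) assms(2) by blast
  ultimately show ?case using add(3) hsum.add[of "h x" gr' i "h y" H] by simp
qed

lemma graded_submoduleD: "graded_submodule R M gr K \<Longrightarrow> submodule K R M"
  by (simp add: graded_submodule_def)

section \<open>Length as a lattice invariant\<close>

text \<open>A saturated chain in the poset of sets satisfying \<open>S\<close>; the covering
  condition stands for simplicity of the factors. Leaving \<open>S\<close> open lets graded and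
  ordinary submodules, over different rings, be treated alike.\<close>

definition cover_chain :: "('b set \<Rightarrow> bool) \<Rightarrow> 'b set \<Rightarrow> 'b set \<Rightarrow> (nat \<Rightarrow> 'b set) \<Rightarrow> nat \<Rightarrow> bool" where
  "cover_chain S N L C n \<longleftrightarrow> C 0 = N \<and> C n = L \<and> (\<forall>i\<le>n. S (C i)) \<and>
     (\<forall>i<n. C i \<subset> C (Suc i) \<and> (\<forall>K. S K \<and> C i \<subseteq> K \<and> K \<subseteq> C (Suc i) \<longrightarrow> K = C i \<or> K = C (Suc i)))"

text \<open>Shaped like \<open>mod_length\<close> and \<open>star_length\<close>, with the same
  \<open>LEAST\<close> and the same default \<infinity>: if chains of each length \<open>n\<close>
  exist on both sides simultaneously, the values agree.\<close>

definition chain_length :: "('b set \<Rightarrow> bool) \<Rightarrow> 'b set \<Rightarrow> 'b set \<Rightarrow> enat" where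
  "chain_length S N L =
     (if \<exists>n C. cover_chain S N L C n then enat (LEAST n. \<exists>C. cover_chain S N L C n) else \<infinity>)"

lemma cover_chain_mono:
  assumes "cover_chain S N L C n" "i \<le> j" "j \<le> n"
  shows "C i \<subseteq> C j"
  using assms(2,3)
proof (induction rule: dec_induct)
  case (step k)
  then have "C k \<subset> C (Suc k)" using assms(1) Suc_le_lessD unfolding cover_chain_def by blast
  then show ?case using step by auto
qed simp

text \<open>Strictness survives because \<open>g\<close> recovers \<open>C i\<close> from its image,
  and a set between two consecutive images is pulled back by \<open>g\<close> to one between
  \<open>C i\<close> and \<open>C (Suc i)\<close>, where the cover leaves only the ends. The maps
  are inverse only between the two intervals, but monotone everywhere, as images, preimages and
  intersections are.\<close>

lemma cover_chain_image:
  assumes C: "cover_chain S N L C n"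
    and f: "\<And>K. \<lbrakk>S K; N \<subseteq> K; K \<subseteq> L\<rbrakk> \<Longrightarrow> T (f K) \<and> g (f K) = K"
    and g: "\<And>K. \<lbrakk>T K; f N \<subseteq> K; K \<subseteq> f L\<rbrakk> \<Longrightarrow> S (g K) \<and> f (g K) = K"
    and mono: "mono f" "mono g"
  shows "cover_chain T (f N) (f L) (f \<circ> C) n"
proof -
  have C0: "C 0 = N" "C n = L" and SC: "S (C i)" if "i \<le> n" for i
    using C that unfolding cover_chain_def by auto
  have range: "N \<subseteq> C i" "C i \<subseteq> L" if "i \<le> n" for i
    using cover_chain_mono[OF C, of 0 i] cover_chain_mono[OF C, of i n] that C0 by auto
  have gf: "g (f (C i)) = C i" and TC: "T (f (C i))" if "i \<le> n" for i
    using f[OF SC range] that by auto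
  have step: "f (C i) \<subset> f (C (Suc i)) \<and>
      (\<forall>K. T K \<and> f (C i) \<subseteq> K \<and> K \<subseteq> f (C (Suc i)) \<longrightarrow> K = f (C i) \<or> K = f (C (Suc i)))"
    if "i < n" for i
  proof -
    have sub: "C i \<subset> C (Suc i)"
      and cov: "\<And>K. \<lbrakk>S K; C i \<subseteq> K; K \<subseteq> C (Suc i)\<rbrakk> \<Longrightarrow> K = C i \<or> K = C (Suc i)"
      using C that unfolding cover_chain_def by auto
    have "f (C i) \<subseteq> f (C (Suc i))" by (rule monoD[OF mono(1)]) (use sub in blast)
    moreover have "f (C i) \<noteq> f (C (Suc i))"
    proof
      assume "f (C i) = f (C (Suc i))"
      then have "g (f (C i)) = g (f (C (Suc i)))" by (rule arg_cong)
      then have "C i = C (Suc i)" using gf[OF less_imp_le[OF that]] gf[OF Suc_leI[OF that]] by metis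
      then show False using sub by blast
    qed
    moreover have "K = f (C i) \<or> K = f (C (Suc i))"
      if K: "T K" "f (C i) \<subseteq> K" "K \<subseteq> f (C (Suc i))" for K
    proof -
      have "f N \<subseteq> K" using K(2) monoD[OF mono(1) range(1)[of i]] \<open>i < n\<close> by auto
      moreover have "K \<subseteq> f L" using K(3) monoD[OF mono(1) range(2)[of "Suc i"]] \<open>i < n\<close> by auto
      ultimately have gK: "S (g K)" "f (g K) = K" using g K(1) by auto
      have "C i \<subseteq> g K" using monoD[OF mono(2) K(2)] gf[of i] \<open>i < n\<close> by simp
      moreover have "g K \<subseteq> C (Suc i)" using monoD[OF mono(2) K(3)] gf[of "Suc i"] \<open>i < n\<close> by simp
      ultimately have "g K = C i \<or> g K = C (Suc i)" using cov gK(1) by blast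
      then show ?thesis using gK(2) by metis
    qed
    ultimately show ?thesis by blast
  qed
  show ?thesis
    unfolding cover_chain_def using C0 TC step by auto
qed

lemma cover_chain_iso:
  assumes f: "\<And>K. \<lbrakk>S K; N \<subseteq> K; K \<subseteq> L\<rbrakk> \<Longrightarrow> T (f K) \<and> g (f K) = K"
    and g: "\<And>K. \<lbrakk>T K; f N \<subseteq> K; K \<subseteq> f L\<rbrakk> \<Longrightarrow> S (g K) \<and> f (g K) = K"
    and mono: "mono f" "mono g"
    and "S N" "S L" "N \<subseteq> L"
  shows "(\<exists>C. cover_chain S N L C n) \<longleftrightarrow> (\<exists>C. cover_chain T (f N) (f L) C n)"
proof
  assume "\<exists>C. cover_chain S N L C n"
  then show "\<exists>C. cover_chain T (f N) (f L) C n"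
    using cover_chain_image[OF _ f g mono] by blast
next
  have gf: "g (f N) = N" "g (f L) = L" using f assms(5-7) by auto
  assume "\<exists>C. cover_chain T (f N) (f L) C n"
  then obtain C where "cover_chain T (f N) (f L) C n" by blast
  then have "cover_chain S (g (f N)) (g (f L)) (g \<circ> C) n"
    by (rule cover_chain_image[where g = f]) (use f g gf mono in auto)
  then show "\<exists>C. cover_chain S N L C n" unfolding gf by blast
qed

lemma chain_length_iso:
  assumes f: "\<And>K. \<lbrakk>S K; N \<subseteq> K; K \<subseteq> L\<rbrakk> \<Longrightarrow> T (f K) \<and> g (f K) = K"
    and g: "\<And>K. \<lbrakk>T K; f N \<subseteq> K; K \<subseteq> f L\<rbrakk> \<Longrightarrow> S (g K) \<and> f (g K) = K"
    and mono: "mono f" "mono g"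
    and "S N" "S L" "N \<subseteq> L"
  shows "chain_length S N L = chain_length T (f N) (f L)"
proof -
  have "(\<exists>C. cover_chain S N L C n) \<longleftrightarrow> (\<exists>C. cover_chain T (f N) (f L) C n)" for n
    by (rule cover_chain_iso[of S N L T f g, OF assms])
  then show ?thesis unfolding chain_length_def by simp
qed

section \<open>Quotient modules and the correspondence between graded submodules\<close>

locale pregraded_quotient = pregraded_module +
  fixes N :: "'c set"
  assumes N: "graded_submodule R M gr N"
begin

abbreviation proj :: "'c \<Rightarrow> 'c set" where "proj x \<equiv> N +>\<^bsub>M\<^esub> x"
abbreviation "Q \<equiv> quot_module M N"
abbreviation "gQ \<equiv> quot_grading M gr N"

lemma N_submodule: "submodule N R M"
  using N graded_submodule_iff by blast

sublocale N: abelian_subgroup N M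
  by (rule abelian_subgroupI3[OF submodule_additive_subgroup[OF N_submodule] M.abelian_group_axioms])

lemma carrier_quot: "carrier Q = proj ` carrier M"
  by (auto simp: quot_module_def A_RCOSETS_def')

lemma zero_quot: "\<zero>\<^bsub>Q\<^esub> = N"
  by (simp add: quot_module_def)

lemma proj_add: "\<lbrakk>x \<in> carrier M; y \<in> carrier M\<rbrakk> \<Longrightarrow> proj x \<oplus>\<^bsub>Q\<^esub> proj y = proj (x \<oplus>\<^bsub>M\<^esub> y)"
  by (simp add: quot_module_def N.a_rcos_sum)

lemma proj_eqD: "\<lbrakk>x \<in> carrier M; y \<in> carrier M; proj x = proj y\<rbrakk> \<Longrightarrow> x \<oplus>\<^bsub>M\<^esub> \<ominus>\<^bsub>M\<^esub> y \<in> N"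
  using N.a_rcos_self N.a_rcos_module_imp by blast

lemma proj_eqI: "\<lbrakk>x \<in> carrier M; y \<in> carrier M; x \<oplus>\<^bsub>M\<^esub> \<ominus>\<^bsub>M\<^esub> y \<in> N\<rbrakk> \<Longrightarrow> proj x = proj y"
  using N.a_rcos_module_rev N.a_repr_independence' by metis

text \<open>The scalar action on cosets is encoded as a union over all representatives. Two
  representatives differ by an element of \<open>N\<close>, which stays in \<open>N\<close> after
  scaling, so every term of the union is the same coset.\<close>

lemma proj_smult:
  assumes "a \<in> carrier R" "x \<in> carrier M"
  shows "a \<odot>\<^bsub>Q\<^esub> proj x = proj (a \<odot>\<^bsub>M\<^esub> x)"
proof -
  have "proj (a \<odot>\<^bsub>M\<^esub> y) = proj (a \<odot>\<^bsub>M\<^esub> x)" if "y \<in> proj x" for y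
  proof -
    have y: "y \<in> carrier M" using N.a_elemrcos_carrier assms(2) that by blast
    have "y \<oplus>\<^bsub>M\<^esub> \<ominus>\<^bsub>M\<^esub> x \<in> N" using N.a_rcos_module_imp assms(2) that by blast
    then have "a \<odot>\<^bsub>M\<^esub> (y \<oplus>\<^bsub>M\<^esub> \<ominus>\<^bsub>M\<^esub> x) \<in> N"
      using submodule.smult_closed[OF N_submodule assms(1)] by blast
    then have "a \<odot>\<^bsub>M\<^esub> y \<oplus>\<^bsub>M\<^esub> \<ominus>\<^bsub>M\<^esub> (a \<odot>\<^bsub>M\<^esub> x) \<in> N"
      using assms y by (simp add: smult_r_distr smult_r_minus)
    then show ?thesis using assms y by (intro proj_eqI) auto
  qed
  moreover have "x \<in> proj x" using N.a_rcos_self assms(2) by blast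
  ultimately have "(\<Union>y\<in>proj x. proj (a \<odot>\<^bsub>M\<^esub> y)) = proj (a \<odot>\<^bsub>M\<^esub> x)" by blast
  then show ?thesis by (simp only: quot_module_def module.select_convs)
qed

lemma quot_module: "module R Q"
proof (rule moduleI)
  show "cring R" by (rule R.is_cring)
  show "abelian_group Q"
  proof (rule abelian_groupI)
    have N_eq: "N = proj \<zero>\<^bsub>M\<^esub>" using N.a_rcos_const N.zero_closed by simp
    show "\<zero>\<^bsub>Q\<^esub> \<in> carrier Q"
      unfolding zero_quot carrier_quot using N_eq by blast
    fix x assume x: "x \<in> carrier Q"
    then obtain x' where x': "x' \<in> carrier M" "x = proj x'" unfolding carrier_quot by blast
    then show "\<zero>\<^bsub>Q\<^esub> \<oplus>\<^bsub>Q\<^esub> x = x"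
      unfolding zero_quot using proj_add[of "\<zero>\<^bsub>M\<^esub>" x'] N_eq by simp
    have "proj (\<ominus>\<^bsub>M\<^esub> x') \<oplus>\<^bsub>Q\<^esub> x = \<zero>\<^bsub>Q\<^esub>"
      unfolding zero_quot using proj_add[of "\<ominus>\<^bsub>M\<^esub> x'" x'] x' N_eq by (simp add: M.l_neg)
    then show "\<exists>y\<in>carrier Q. y \<oplus>\<^bsub>Q\<^esub> x = \<zero>\<^bsub>Q\<^esub>"
      unfolding carrier_quot using x'(1) by blast
    fix y assume y: "y \<in> carrier Q"
    show "x \<oplus>\<^bsub>Q\<^esub> y \<in> carrier Q" using x y unfolding carrier_quot by (auto simp: proj_add)
    show "x \<oplus>\<^bsub>Q\<^esub> y = y \<oplus>\<^bsub>Q\<^esub> x"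
      using x y unfolding carrier_quot by (auto simp: proj_add M.a_comm)
    fix z assume "z \<in> carrier Q"
    then show "x \<oplus>\<^bsub>Q\<^esub> y \<oplus>\<^bsub>Q\<^esub> z = x \<oplus>\<^bsub>Q\<^esub> (y \<oplus>\<^bsub>Q\<^esub> z)"
      using x y unfolding carrier_quot by (auto simp: proj_add M.a_assoc)
  qed
next
  fix a x assume "a \<in> carrier R" "x \<in> carrier Q"
  then show "a \<odot>\<^bsub>Q\<^esub> x \<in> carrier Q"
    unfolding carrier_quot by (auto simp: proj_smult)
next
  fix a b x assume "a \<in> carrier R" "b \<in> carrier R" "x \<in> carrier Q"
  then show "(a \<oplus> b) \<odot>\<^bsub>Q\<^esub> x = a \<odot>\<^bsub>Q\<^esub> x \<oplus>\<^bsub>Q\<^esub> b \<odot>\<^bsub>Q\<^esub> x"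
    unfolding carrier_quot by (auto simp: proj_smult proj_add smult_l_distr)
next
  fix a x y assume "a \<in> carrier R" "x \<in> carrier Q" "y \<in> carrier Q"
  then show "a \<odot>\<^bsub>Q\<^esub> (x \<oplus>\<^bsub>Q\<^esub> y) = a \<odot>\<^bsub>Q\<^esub> x \<oplus>\<^bsub>Q\<^esub> a \<odot>\<^bsub>Q\<^esub> y"
    unfolding carrier_quot by (auto simp: proj_smult proj_add smult_r_distr)
next
  fix a b x assume "a \<in> carrier R" "b \<in> carrier R" "x \<in> carrier Q"
  then show "a \<otimes> b \<odot>\<^bsub>Q\<^esub> x = a \<odot>\<^bsub>Q\<^esub> (b \<odot>\<^bsub>Q\<^esub> x)"
    unfolding carrier_quot by (auto simp: proj_smult smult_assoc1)
next
  fix x assume "x \<in> carrier Q"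
  then show "\<one> \<odot>\<^bsub>Q\<^esub> x = x"
    unfolding carrier_quot by (auto simp: proj_smult)
qed

lemma proj_hom: "abelian_group_hom M Q proj"
proof -
  have Q: "abelian_group Q" using quot_module by (rule module.axioms(2))
  show ?thesis
  proof (rule abelian_group_homI[OF M.abelian_group_axioms Q])
    show "group_hom (add_monoid M) (add_monoid Q) proj"
    proof (rule group_hom.intro[OF M.a_group abelian_group.a_group[OF Q] group_hom_axioms.intro])
      show "proj \<in> hom (add_monoid M) (add_monoid Q)"
        by (rule homI) (simp_all add: proj_add carrier_quot)
    qed
  qed
qed

lemma quot_grading_eq: "gQ i = proj ` gr i"
  by (simp add: quot_grading_def)

lemma proj_image_subgroup:
  assumes "additive_subgroup K M"
  shows "additive_subgroup (proj ` K) Q"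
  using group_hom.subgroup_img_is_subgroup[OF abelian_group_hom.a_group_hom[OF proj_hom]] assms
  by (simp add: additive_subgroup_def)

lemma quot_pregraded: "pregraded_module R Q gQ"
  by (intro pregraded_module.intro quot_module pregraded_module_axioms.intro)
    (simp only: quot_grading_eq proj_image_subgroup[OF gr_subgroup])

lemma graded_submodule_image:
  assumes "graded_submodule R M gr K"
  shows "graded_submodule R Q gQ (proj ` K)"
proof -
  interpret gQ: pregraded_module R Q gQ by (rule quot_pregraded)
  interpret proj: abelian_group_hom M Q proj by (rule proj_hom)
  have K: "submodule K R M" "K \<subseteq> hsum M (\<lambda>i. gr i \<inter> K)"
    using assms graded_submodule_iff by auto
  note KE = submoduleE[OF K(1)]
  have "submodule (proj ` K) R Q"
  proof (rule submodule.intro)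
    show "subgroup (proj ` K) (add_monoid Q)"
      using proj_image_subgroup[OF submodule_additive_subgroup[OF K(1)]]
      by (rule additive_subgroup.a_subgroup)
    show "submodule_axioms (proj ` K) R Q"
    proof
      fix a X assume "a \<in> carrier R" "X \<in> proj ` K"
      then show "a \<odot>\<^bsub>Q\<^esub> X \<in> proj ` K"
        using KE(1,4) by (auto simp: proj_smult subset_iff)
    qed
  qed
  moreover have "proj x \<in> hsum Q (\<lambda>i. gQ i \<inter> proj ` K)" if "x \<in> K" for x
    by (rule proj.hsum_image[of "\<lambda>i. gr i \<inter> K"])
      (use K that gr_subset quot_grading_eq in auto)
  ultimately show ?thesis unfolding gQ.graded_submodule_iff by blast
qed

definition preim :: "'c set set \<Rightarrow> 'c set" where
  "preim K = {x \<in> carrier M. proj x \<in> K}"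

lemma mono_preim: "mono preim"
  by (auto simp: preim_def mono_def)

lemma subset_preim:
  assumes "submodule K R Q"
  shows "N \<subseteq> preim K"
proof
  fix x assume "x \<in> N"
  then have "proj x = N" "x \<in> carrier M" using N.a_rcos_const N.a_subset by blast+
  moreover have "N \<in> K" using subgroup.one_closed[OF submodule.axioms(1)[OF assms]] zero_quot by simp
  ultimately show "x \<in> preim K" by (simp add: preim_def)
qed

lemma proj_preim: "K \<subseteq> carrier Q \<Longrightarrow> proj ` preim K = K"
  unfolding preim_def carrier_quot by auto

lemma preim_proj:
  assumes "submodule K R M" "N \<subseteq> K"
  shows "preim (proj ` K) = K"
proof
  note KE = submoduleE[OF assms(1)]
  show "K \<subseteq> preim (proj ` K)" using KE(1) unfolding preim_def by blast
  show "preim (proj ` K) \<subseteq> K"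
  proof
    fix x assume "x \<in> preim (proj ` K)"
    then obtain y where xy: "x \<in> carrier M" "y \<in> K" "proj x = proj y"
      unfolding preim_def by blast
    then have y: "y \<in> carrier M" using KE(1) by blast
    have "x \<oplus>\<^bsub>M\<^esub> \<ominus>\<^bsub>M\<^esub> y \<in> K" using proj_eqD[OF xy(1) y xy(3)] assms(2) by blast
    then have "x \<oplus>\<^bsub>M\<^esub> \<ominus>\<^bsub>M\<^esub> y \<oplus>\<^bsub>M\<^esub> y \<in> K" using KE(5) xy(2) by blast
    then show "x \<in> K" using xy(1) y by (simp add: M.a_assoc M.l_neg)
  qed
qed

text \<open>Lifting a decomposition of \<open>proj x\<close> summand by summand yields some
  \<open>y\<close> with the same image as \<open>x\<close>, but not \<open>x\<close> itself. The
  error lies in \<open>N\<close>, and because \<open>N\<close> is graded the error decomposes as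
  well.\<close>

lemma graded_submodule_preim:
  assumes "graded_submodule R Q gQ K"
  shows "graded_submodule R M gr (preim K)"
proof -
  interpret gQ: pregraded_module R Q gQ by (rule quot_pregraded)
  interpret proj: abelian_group_hom M Q proj by (rule proj_hom)
  have K: "submodule K R Q" "K \<subseteq> hsum Q (\<lambda>i. gQ i \<inter> K)"
    using assms gQ.graded_submodule_iff by auto
  note KE = gQ.submoduleE[OF K(1)]
  have sub: "submodule (preim K) R M"
  proof (rule submoduleI)
    show "preim K \<subseteq> carrier M" by (auto simp: preim_def)
    show "\<zero>\<^bsub>M\<^esub> \<in> preim K" using subset_preim[OF K(1)] N.zero_closed by blast
    show "\<ominus>\<^bsub>M\<^esub> a \<in> preim K" if "a \<in> preim K" for a
      using that KE(3) proj.hom_a_inv[of a] by (auto simp: preim_def)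
    show "a \<oplus>\<^bsub>M\<^esub> b \<in> preim K" if "a \<in> preim K" "b \<in> preim K" for a b
      using that KE(5) proj.hom_add[of a b] by (auto simp: preim_def)
    show "a \<odot>\<^bsub>M\<^esub> x \<in> preim K" if "a \<in> carrier R" "x \<in> preim K" for a x
      using that KE(4)[of a "proj x"] proj_smult[of a x] by (auto simp: preim_def)
  qed
  let ?g = "\<lambda>i. gr i \<inter> preim K"
  have g: "?g i \<subseteq> carrier M" for i using gr_subset by blast
  \<comment> \<open>A homogeneous coset has a representative of the same degree by the definition of
    \<open>quot_grading\<close>, and that representative lies in \<open>preim K\<close> because its
    image lies in \<open>K\<close>.\<close>
  have lift: "\<exists>y \<in> hsum M ?g. proj y = X" if "X \<in> hsum Q (\<lambda>i. gQ i \<inter> K)" for X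
    using that
  proof induction
    case zero
    have "proj \<zero>\<^bsub>M\<^esub> = \<zero>\<^bsub>Q\<^esub>" by (rule proj.hom_zero)
    then show ?case using hsum.zero[of M ?g] by blast
  next
    case (add X i Y)
    then obtain x y where xy: "x \<in> gr i" "X = proj x" "y \<in> hsum M ?g" "proj y = Y"
      by (auto simp: quot_grading_eq)
    have "x \<in> carrier M" using xy(1) gr_subset by blast
    moreover have "y \<in> carrier M" using M.hsum_closed[of ?g, OF g xy(3)] .
    moreover have "x \<in> ?g i" using add(1) xy(1,2) \<open>x \<in> carrier M\<close> by (simp add: preim_def)
    ultimately show ?case
      using hsum.add[of x ?g i y M] xy proj_add[of x y] by blast
  qed
  have "x \<in> hsum M ?g" if x: "x \<in> preim K" for x
  proof -
    have xc: "x \<in> carrier M" and "proj x \<in> hsum Q (\<lambda>i. gQ i \<inter> K)"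
      using x K(2) by (auto simp: preim_def)
    then obtain y where y: "y \<in> hsum M ?g" "proj y = proj x" using lift by blast
    have yc: "y \<in> carrier M" using M.hsum_closed[of ?g, OF g y(1)] .
    have "x \<oplus>\<^bsub>M\<^esub> \<ominus>\<^bsub>M\<^esub> y \<in> N" using proj_eqD[OF xc yc] y(2) by simp
    then have "x \<oplus>\<^bsub>M\<^esub> \<ominus>\<^bsub>M\<^esub> y \<in> hsum M (\<lambda>i. gr i \<inter> N)" using N graded_submodule_iff by blast
    then have "x \<oplus>\<^bsub>M\<^esub> \<ominus>\<^bsub>M\<^esub> y \<in> hsum M ?g"
      using hsum_mono[of "\<lambda>i. gr i \<inter> N" ?g M] subset_preim[OF K(1)] by blast
    then have "x \<oplus>\<^bsub>M\<^esub> \<ominus>\<^bsub>M\<^esub> y \<oplus>\<^bsub>M\<^esub> y \<in> hsum M ?g"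
      using M.hsum_add[of ?g, OF g] y(1) by blast
    then show ?thesis using xc yc by (simp add: M.a_assoc M.l_neg)
  qed
  then show ?thesis unfolding graded_submodule_iff using sub by blast
qed

lemma proj_N: "proj ` N = {\<zero>\<^bsub>Q\<^esub>}"
proof -
  have "proj ` N = (\<lambda>_. N) ` N" using N.a_rcos_const by (rule image_cong[OF refl])
  then show ?thesis unfolding zero_quot using image_constant[OF N.zero_closed] by metis
qed

lemma chain_length_quot:
  assumes "graded_submodule R M gr L" "N \<subseteq> L"
  shows "chain_length (graded_submodule R M gr) N L
    = chain_length (graded_submodule R Q gQ) {\<zero>\<^bsub>Q\<^esub>} (proj ` L)"
proof -
  interpret gQ: pregraded_module R Q gQ by (rule quot_pregraded)
  have "chain_length (graded_submodule R M gr) N L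
    = chain_length (graded_submodule R Q gQ) (proj ` N) (proj ` L)"
  proof (rule chain_length_iso[where g = preim])
    fix K assume K: "graded_submodule R M gr K" "N \<subseteq> K"
    show "graded_submodule R Q gQ (proj ` K) \<and> preim (proj ` K) = K"
      using graded_submodule_image[OF K(1)] preim_proj[OF graded_submoduleD[OF K(1)] K(2)] ..
  next
    fix K assume K: "graded_submodule R Q gQ K"
    show "graded_submodule R M gr (preim K) \<and> proj ` preim K = K"
      using graded_submodule_preim[OF K]
        proj_preim[OF gQ.submoduleE(1)[OF graded_submoduleD[OF K]]] ..
  next
    show "mono ((`) proj)" by (rule monoI) (rule image_mono)
  qed (fact assms N mono_preim)+
  then show ?thesis unfolding proj_N .
qed

text \<open>Under the correspondence the zero submodule of the quotient belongs to \<open>N\<close>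
  and the whole quotient to \<open>carrier M\<close>, so *simplicity turns into the covering
  condition of \<open>cover_chain\<close>.\<close>

lemma star_simple_quot_iff:
  "star_simple R Q gQ \<longleftrightarrow>
     N \<noteq> carrier M \<and> (\<forall>K. graded_submodule R M gr K \<and> N \<subseteq> K \<longrightarrow> K = N \<or> K = carrier M)"
proof -
  interpret gQ: pregraded_module R Q gQ by (rule quot_pregraded)
  have pre0: "preim {\<zero>\<^bsub>Q\<^esub>} = N" by (rule preim_proj[OF N_submodule subset_refl, unfolded proj_N])
  have pre1: "preim (carrier Q) = carrier M" unfolding preim_def carrier_quot by blast
  have "(carrier Q = {\<zero>\<^bsub>Q\<^esub>}) = (N = carrier M)"
  proof
    assume "carrier Q = {\<zero>\<^bsub>Q\<^esub>}"
    then have "preim (carrier Q) = preim {\<zero>\<^bsub>Q\<^esub>}" by (rule arg_cong)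
    then show "N = carrier M" unfolding pre0 pre1 ..
  next
    assume "N = carrier M"
    then have "proj ` N = proj ` carrier M" by (rule arg_cong)
    then show "carrier Q = {\<zero>\<^bsub>Q\<^esub>}" unfolding proj_N carrier_quot ..
  qed
  moreover have "(\<forall>K. graded_submodule R Q gQ K \<longrightarrow> K = {\<zero>\<^bsub>Q\<^esub>} \<or> K = carrier Q) \<longleftrightarrow>
    (\<forall>K. graded_submodule R M gr K \<and> N \<subseteq> K \<longrightarrow> K = N \<or> K = carrier M)" (is "?A \<longleftrightarrow> ?B")
  proof
    assume A: ?A
    show ?B
    proof (intro allI impI, elim conjE)
      fix K assume K: "graded_submodule R M gr K" "N \<subseteq> K"
      have eq: "preim (proj ` K) = K" by (rule preim_proj[OF graded_submoduleD[OF K(1)] K(2)])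
      have "proj ` K = {\<zero>\<^bsub>Q\<^esub>} \<or> proj ` K = carrier Q"
        using A graded_submodule_image[OF K(1)] by blast
      then show "K = N \<or> K = carrier M" using eq pre0 pre1 by auto
    qed
  next
    assume B: ?B
    show ?A
    proof (intro allI impI)
      fix K assume K: "graded_submodule R Q gQ K"
      note K' = graded_submoduleD[OF K]
      have eq: "proj ` preim K = K" by (rule proj_preim[OF gQ.submoduleE(1)[OF K']])
      have "preim K = N \<or> preim K = carrier M"
        using B graded_submodule_preim[OF K] subset_preim[OF K'] by blast
      then have "proj ` preim K = proj ` N \<or> proj ` preim K = proj ` carrier M" by metis
      then show "K = {\<zero>\<^bsub>Q\<^esub>} \<or> K = carrier Q" unfolding eq proj_N carrier_quot .
    qed
  qed
  ultimately show ?thesis unfolding star_simple_def by blast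
qed

end

section \<open>Composition series as saturated chains\<close>

context pregraded_module
begin

lemma star_comp_series_iff:
  "star_comp_series R M gr C n \<longleftrightarrow>
    cover_chain (graded_submodule R M gr) {\<zero>\<^bsub>M\<^esub>} (carrier M) C n"
proof -
  have simple_iff: "star_simple R (quot_module (M\<lparr>carrier := L\<rparr>) K)
      (quot_grading (M\<lparr>carrier := L\<rparr>) (\<lambda>j. gr j \<inter> L) K) \<longleftrightarrow>
    (\<forall>X. graded_submodule R M gr X \<and> K \<subseteq> X \<and> X \<subseteq> L \<longrightarrow> X = K \<or> X = L)"
    if K: "graded_submodule R M gr K" and L: "graded_submodule R M gr L" and KL: "K \<subset> L" for K L
  proof -
    note L' = graded_submoduleD[OF L]
    note sub_iff = graded_submodule_of_submodule_iff[OF L']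
    interpret L: pregraded_module R "M\<lparr>carrier := L\<rparr>" "\<lambda>i. gr i \<inter> L"
      by (rule pregraded_submodule[OF L'])
    interpret LK: pregraded_quotient R "M\<lparr>carrier := L\<rparr>" "\<lambda>i. gr i \<inter> L" K
      by (intro pregraded_quotient.intro L.pregraded_module_axioms pregraded_quotient_axioms.intro)
        (simp add: sub_iff K psubset_imp_subset[OF KL])
    have "K \<noteq> L" using KL by blast
    then show ?thesis unfolding LK.star_simple_quot_iff sub_iff by auto
  qed
  \<comment> \<open>The congruence rules supply gradedness of the members and the strict inclusion
    \<open>C i \<subset> C (Suc i)\<close>, on which \<open>simple_iff\<close> depends.\<close>
  show ?thesis
    unfolding star_comp_series_def cover_chain_def
    by (intro conj_cong refl all_cong imp_cong simple_iff) simp_all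
qed

lemma star_length_eq: "star_length R M gr = chain_length (graded_submodule R M gr) {\<zero>\<^bsub>M\<^esub>} (carrier M)"
  unfolding star_length_def chain_length_def star_comp_series_iff ..

end

section \<open>Ordinary length as the *length for a constant family\<close>

context module
begin

lemma pregraded_trivial: "pregraded_module R M (\<lambda>_. carrier M)"
  by (intro pregraded_module.intro module_axioms pregraded_module_axioms.intro
      M.carrier_additive_subgroup)

text \<open>For the constant family every element is homogeneous of degree \<open>0\<close>, so each
  element of \<open>N\<close> is its own decomposition.\<close>

lemma graded_submodule_trivial: "graded_submodule R M (\<lambda>_. carrier M) N \<longleftrightarrow> submodule N R M"
proof -
  interpret pregraded_module R M "\<lambda>_. carrier M" by (rule pregraded_trivial)
  have "N \<subseteq> hsum M (\<lambda>i. carrier M \<inter> N)" if "submodule N R M"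
    using submoduleE(1)[OF that] M.hsum_homogeneous[of "\<lambda>i. carrier M \<inter> N" 0] by blast
  then show ?thesis unfolding graded_submodule_iff by blast
qed

lemma star_simple_trivial: "star_simple R M (\<lambda>_. carrier M) \<longleftrightarrow> simple_module R M"
  unfolding star_simple_def simple_module_def graded_submodule_trivial ..

text \<open>The family that a factor inherits from the constant family is again constant, equal to
  the carrier of the factor; for it *simple and simple coincide.\<close>

lemma comp_series_iff:
  "comp_series R M C n \<longleftrightarrow> star_comp_series R M (\<lambda>_. carrier M) C n"
proof -
  interpret T: pregraded_module R M "\<lambda>_. carrier M" by (rule pregraded_trivial)
  have simple_iff: "star_simple R (quot_module (M\<lparr>carrier := L\<rparr>) K)
      (quot_grading (M\<lparr>carrier := L\<rparr>) (\<lambda>j. carrier M \<inter> L) K) \<longleftrightarrow>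
    simple_module R (quot_module (M\<lparr>carrier := L\<rparr>) K)"
    if K: "submodule K R M" and L: "submodule L R M" and KL: "K \<subset> L" for K L
  proof -
    interpret L: pregraded_module R "M\<lparr>carrier := L\<rparr>" "\<lambda>i. carrier M \<inter> L"
      by (rule T.pregraded_submodule[OF L])
    interpret LK: pregraded_quotient R "M\<lparr>carrier := L\<rparr>" "\<lambda>i. carrier M \<inter> L" K
      by (intro pregraded_quotient.intro L.pregraded_module_axioms pregraded_quotient_axioms.intro)
        (simp add: T.graded_submodule_of_submodule_iff[OF L] graded_submodule_trivial K
          psubset_imp_subset[OF KL])
    have "carrier M \<inter> L = L" using submoduleE(1)[OF L] by blast
    then have "LK.gQ = (\<lambda>_. carrier LK.Q)"
      unfolding LK.carrier_quot quot_grading_def by simp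
    then show ?thesis using module.star_simple_trivial[OF LK.quot_module] by simp
  qed
  show ?thesis
    unfolding star_comp_series_def comp_series_def graded_submodule_trivial
    by (intro conj_cong refl all_cong imp_cong simple_iff[symmetric]) simp_all
qed

lemma mod_length_eq_star_length: "mod_length R M = star_length R M (\<lambda>_. carrier M)"
  unfolding mod_length_def star_length_def comp_series_iff ..

end

lemma (in pregraded_quotient) star_length_quot:
  assumes "graded_submodule R M gr (carrier M)"
  shows "star_length R Q gQ = chain_length (graded_submodule R M gr) N (carrier M)"
  using pregraded_module.star_length_eq[OF quot_pregraded] chain_length_quot[OF assms N.a_subset] carrier_quot by simp

lemma (in module) mod_length_quot:
  assumes "submodule N R M"
  shows "mod_length R (quot_module M N) = chain_length (\<lambda>K. submodule K R M) N (carrier M)"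
proof -
  interpret T: pregraded_quotient R M "\<lambda>_. carrier M" N
    by (intro pregraded_quotient.intro pregraded_trivial pregraded_quotient_axioms.intro)
      (simp add: graded_submodule_trivial assms)
  have "T.gQ = (\<lambda>_. carrier T.Q)" by (simp add: fun_eq_iff T.carrier_quot T.quot_grading_eq)
  moreover have sub_eq: "graded_submodule R M (\<lambda>_. carrier M) = (\<lambda>K. submodule K R M)"
    by (rule ext) (rule graded_submodule_trivial)
  ultimately show ?thesis
    using module.mod_length_eq_star_length[OF T.quot_module] T.star_length_quot
      carrier_is_submodule by simp
qed

section \<open>Homogeneous units\<close>

locale graded_group = abelian_group G for G :: "('a, 'x) ring_scheme" (structure) +
  fixes gr :: "int \<Rightarrow> 'a set"
  assumes grading: "grading G gr"
begin

definition component :: "'a \<Rightarrow> int \<Rightarrow> 'a" where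
  "component x = (THE f. hom_decomp G gr x f)"

lemma gr_subgroup: "additive_subgroup (gr i) G"
  using grading by (simp add: grading_def)

lemma gr_subset: "gr i \<subseteq> carrier G"
  by (rule additive_subgroup.a_subset[OF gr_subgroup])

lemma gr_closed: "x \<in> gr i \<Longrightarrow> x \<in> carrier G"
  using gr_subset by blast

lemma carrier_eq_hsum: "carrier G = hsum G gr"
proof
  show "carrier G \<subseteq> hsum G gr"
  proof
    fix x assume "x \<in> carrier G"
    then have "\<exists>f. hom_decomp G gr x f" using grading unfolding grading_def by blast
    then show "x \<in> hsum G gr" unfolding hsum_iff_hom_decomp[of gr, OF gr_subgroup] .
  qed
  show "hsum G gr \<subseteq> carrier G"
    by (rule hsum_subset[OF carrier_additive_subgroup gr_subset])
qed

lemma component_unique: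
  assumes "hom_decomp G gr x f"
  shows "component x = f"
proof -
  have "\<exists>f. hom_decomp G gr x f" using assms by blast
  then have "x \<in> carrier G"
    unfolding hsum_iff_hom_decomp[of gr, OF gr_subgroup, symmetric] carrier_eq_hsum .
  then have "\<exists>!f. hom_decomp G gr x f" using grading unfolding grading_def by blast
  then show ?thesis unfolding component_def by (rule the1_equality) (rule assms)
qed

lemma hom_decomp_component:
  assumes "x \<in> carrier G"
  shows "hom_decomp G gr x (component x)"
proof -
  have "\<exists>!f. hom_decomp G gr x f" using assms grading unfolding grading_def by blast
  then show ?thesis unfolding component_def by (rule theI')
qed

lemma component_in: "x \<in> carrier G \<Longrightarrow> component x i \<in> gr i"
  using hom_decomp_component unfolding hom_decomp_def by blast

lemma component_add:
  assumes "x \<in> carrier G" "y \<in> carrier G"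
  shows "component (x \<oplus> y) i = component x i \<oplus> component y i"
proof -
  have "component (x \<oplus> y) = (\<lambda>i. component x i \<oplus> component y i)"
    by (rule component_unique[OF hom_decomp_add[OF gr_subgroup hom_decomp_component[OF assms(1)]
            hom_decomp_component[OF assms(2)]]])
  then show ?thesis by (rule fun_cong)
qed

lemma component_homogeneous:
  assumes "x \<in> gr j"
  shows "component x i = (if i = j then x else \<zero>)"
proof -
  have "component x = (\<lambda>i. if i = j then x else \<zero>)"
    by (rule component_unique[OF hom_decomp_homogeneous[of gr, OF gr_subgroup assms]])
  then show ?thesis by (rule fun_cong)
qed

lemma zero_gr: "\<zero> \<in> gr i"
  by (rule additive_subgroup.zero_closed[OF gr_subgroup])

lemma component_zero: "component \<zero> i = \<zero>"
  using component_homogeneous[OF zero_gr[of 0]] by simp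

end

lemma (in graded_ring) graded_group: "graded_group A gA"
  by (rule graded_group.intro[OF abelian_group_axioms graded_group_axioms.intro[OF ring_grading]])

lemma graded_ideal_iff:
  assumes "graded_ring A gA"
  shows "graded_ideal A gA I \<longleftrightarrow> ideal I A \<and> I \<subseteq> hsum A (\<lambda>i. gA i \<inter> I)"
proof (cases "ideal I A")
  case True
  interpret graded_ring A gA by fact
  interpret g: graded_group A gA by (rule graded_group)
  have "additive_subgroup (gA i \<inter> I) A" for i
    by (rule additive_subgroupI[OF add.subgroups_Inter_pair[OF
            additive_subgroup.a_subgroup[OF g.gr_subgroup]
            additive_subgroup.a_subgroup[OF ideal.axioms(1)[OF True]]]])
  then show ?thesis
    using hsum_iff_hom_decomp[of "\<lambda>i. gA i \<inter> I"] True unfolding graded_ideal_def by blast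
qed (simp add: graded_ideal_def)

context graded_ring
begin

interpretation g: graded_group A gA by (rule graded_group)

text \<open>Components are additive, so it suffices to treat homogeneous \<open>x\<close>, where
  both sides vanish unless the degrees match. Comparing a single component of an identity is what
  locates the unit and homogeneous inverses below.\<close>

lemma component_mult:
  assumes "a \<in> gA j" "x \<in> carrier A"
  shows "g.component (a \<otimes> x) (j + i) = a \<otimes> g.component x i"
proof -
  have a: "a \<in> carrier A" by (rule g.gr_closed[OF assms(1)])
  have "x \<in> hsum A gA" using assms(2) g.carrier_eq_hsum by simp
  then show ?thesis
  proof induction
    case zero show ?case using a by (simp add: g.component_zero)
  next
    case (add y k z)
    have y: "y \<in> carrier A" by (rule g.gr_closed[OF add(1)])
    have z: "z \<in> carrier A" using add(2) g.carrier_eq_hsum by simp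
    have ay: "a \<otimes> y \<in> gA (j + k)" by (rule ring_grading_mult[OF assms(1) add(1)])
    have "g.component (a \<otimes> y) (j + i) = a \<otimes> g.component y i"
      using a unfolding g.component_homogeneous[OF ay] g.component_homogeneous[OF add(1)] by simp
    moreover have "g.component y i \<in> carrier A" "g.component z i \<in> carrier A"
      by (rule g.gr_closed[OF g.component_in[OF y]]) (rule g.gr_closed[OF g.component_in[OF z]])
    ultimately show ?case
      using a y z add(3) by (simp add: g.component_add r_distr)
  qed
qed

text \<open>Let \<open>e\<close> be the degree-zero component of \<open>\<one>\<close>. For
  \<open>y\<close> homogeneous of degree \<open>k\<close>, the component of degree \<open>k\<close>
  in \<open>y \<otimes> \<one> = y\<close> reads \<open>y \<otimes> e = y\<close>. Hence
  \<open>e\<close> is neutral on all sums of homogeneous elements, in particular on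
  \<open>\<one>\<close>, and so \<open>e = \<one>\<close>.\<close>

lemma one_degree_zero: "\<one> \<in> gA 0"
proof -
  let ?e = "g.component \<one> 0"
  have e: "?e \<in> gA 0" by (rule g.component_in[OF one_closed])
  have ec: "?e \<in> carrier A" by (rule g.gr_closed[OF e])
  have "x \<otimes> ?e = x" if "x \<in> hsum A gA" for x
    using that
  proof induction
    case zero show ?case using ec by simp
  next
    case (add y k z)
    have y: "y \<in> carrier A" by (rule g.gr_closed[OF add(1)])
    have z: "z \<in> carrier A" using add(2) g.carrier_eq_hsum by simp
    have "y \<otimes> ?e = y"
      using component_mult[OF add(1) one_closed, of 0] y
      by (simp add: g.component_homogeneous[OF add(1)])
    then show ?case using y z ec add(3) by (simp add: l_distr)
  qed
  then have "\<one> \<otimes> ?e = \<one>" using g.carrier_eq_hsum one_closed by blast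
  then show ?thesis using e ec by simp
qed

text \<open>Only the component of \<open>u\<close> in degree \<open>- j\<close> contributes to the
  degree-zero part of \<open>t \<otimes> u\<close>, and \<open>\<one>\<close> is its own degree-zero
  part.\<close>

lemma homogeneous_inverse:
  assumes "t \<in> gA j" "u \<in> carrier A" "t \<otimes> u = \<one>"
  shows "\<exists>s \<in> gA (- j). t \<otimes> s = \<one>"
proof
  show "g.component u (- j) \<in> gA (- j)" by (rule g.component_in[OF assms(2)])
  show "t \<otimes> g.component u (- j) = \<one>"
    using component_mult[OF assms(1,2), of "- j"] assms(3)
      g.component_homogeneous[OF one_degree_zero, of 0] by simp
qed

text \<open>Multiplying a homogeneous decomposition of \<open>x\<close> by the homogeneous
  \<open>t\<close> decomposes \<open>x \<otimes> t\<close> into summands that are again multiples of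
  \<open>t\<close>.\<close>

lemma cgenideal_graded:
  assumes "t \<in> gA j"
  shows "graded_ideal A gA (PIdl t)"
  unfolding graded_ideal_iff[OF graded_ring_axioms]
proof
  have t: "t \<in> carrier A" by (rule g.gr_closed[OF assms])
  show I: "ideal (PIdl t) A" by (rule cgenideal_ideal[OF t])
  have "x \<otimes> t \<in> hsum A (\<lambda>i. gA i \<inter> PIdl t)" if "x \<in> hsum A gA" for x
    using that
  proof induction
    case zero show ?case using t hsum.zero[of A] by simp
  next
    case (add y k z)
    have y: "y \<in> carrier A" by (rule g.gr_closed[OF add(1)])
    have z: "z \<in> carrier A" using add(2) g.carrier_eq_hsum by simp
    have "y \<otimes> t \<in> gA (k + j) \<inter> PIdl t"
      using ring_grading_mult[OF add(1) assms] y unfolding cgenideal_def by blast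
    then show ?case using y z t add(3) hsum.add[of "y \<otimes> t" "\<lambda>i. gA i \<inter> PIdl t" "k + j" _ A]
      by (simp add: l_distr)
  qed
  then show "PIdl t \<subseteq> hsum A (\<lambda>i. gA i \<inter> PIdl t)"
    using g.carrier_eq_hsum unfolding cgenideal_def by blast
qed

text \<open>Zorn's lemma among the proper graded ideals above \<open>J\<close>. By the Noetherian
  property the union of a nonempty chain belongs to the chain, and so it is graded and proper as a
  member.\<close>

lemma graded_ideal_subset_star_maximal:
  assumes "noetherian_ring A" "graded_ideal A gA J" "J \<noteq> carrier A"
  shows "\<exists>Q. star_maximal A gA Q \<and> J \<subseteq> Q"
proof -
  let ?S = "{K. graded_ideal A gA K \<and> K \<noteq> carrier A \<and> J \<subseteq> K}"
  have "\<exists>Q\<in>?S. \<forall>X\<in>?S. Q \<subseteq> X \<longrightarrow> X = Q"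
  proof (rule subset_Zorn)
    fix C assume C: "subset.chain ?S C"
    show "\<exists>U\<in>?S. \<forall>X\<in>C. X \<subseteq> U"
    proof (cases "C = {}")
      case True then show ?thesis using assms(2,3) by blast
    next
      case False
      have "subset.chain {I. ideal I A} C"
        using C unfolding pred_on.chain_def graded_ideal_def by blast
      then have "\<Union>C \<in> C" by (rule noetherian_ring.ideal_chain_is_trivial[OF assms(1) False])
      moreover have "C \<subseteq> ?S" using C unfolding pred_on.chain_def by (rule conjunct1)
      ultimately have "\<Union>C \<in> ?S" by (rule rev_subsetD)
      then show ?thesis by (rule rev_bexI) blast
    qed
  qed
  then obtain Q where Q: "Q \<in> ?S" and max: "\<forall>X\<in>?S. Q \<subseteq> X \<longrightarrow> X = Q" by (rule bexE)
  have "X = Q" if X: "graded_ideal A gA X" "X \<noteq> carrier A" "Q \<subseteq> X" for X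
  proof -
    have "J \<subseteq> X" using X(3) Q by auto
    then have "X \<in> ?S" using X by simp
    with max have "Q \<subseteq> X \<longrightarrow> X = Q" by (rule bspec)
    then show ?thesis using X(3) by (rule mp)
  qed
  then have "star_maximal A gA Q" unfolding star_maximal_def using Q by simp
  then show ?thesis using Q by (intro exI[of _ Q]) simp
qed

lemma star_local_homogeneous_unit:
  assumes "noetherian_ring A" "star_local A gA P" "t \<in> gA j" "t \<notin> P"
  shows "\<exists>s \<in> gA (- j). t \<otimes> s = \<one>"
proof -
  have t: "t \<in> carrier A" by (rule g.gr_closed[OF assms(3)])
  have "PIdl t = carrier A"
  proof (rule ccontr)
    assume "PIdl t \<noteq> carrier A"
    then obtain Q where "star_maximal A gA Q" "PIdl t \<subseteq> Q"
      using graded_ideal_subset_star_maximal[OF assms(1) cgenideal_graded[OF assms(3)]] by blast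
    then show False using assms(2,4) cgenideal_self[OF t] unfolding star_local_def by blast
  qed
  then have "\<one> \<in> PIdl t" by simp
  then obtain u where u: "u \<in> carrier A" "\<one> = u \<otimes> t" by (auto simp: cgenideal_def)
  then have "t \<otimes> u = \<one>" using t m_comm[of t u] by simp
  then show ?thesis by (rule homogeneous_inverse[OF assms(3) u(1)])
qed

text \<open>These are the integral powers of \<open>t\<close>, with powers of \<open>s\<close> for
  negative exponents. The law for exponents of mixed sign is reduced to the shifts by one,
  \<open>up\<close> and \<open>down\<close>, from which induction over the integers in both
  directions builds it.\<close>

lemma homogeneous_powers:
  assumes "t \<in> gA 1" "s \<in> gA (- 1)" "t \<otimes> s = \<one>"
  shows "\<exists>tp. (\<forall>i. tp i \<in> gA i) \<and> (\<forall>i j. tp i \<otimes> tp j = tp (i + j)) \<and> tp 0 = \<one>"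
proof -
  have tc: "t \<in> carrier A" and sc: "s \<in> carrier A"
    using g.gr_closed[OF assms(1)] g.gr_closed[OF assms(2)] .
  define tp where "tp i = (if i \<ge> 0 then t [^] nat i else s [^] nat (- i))" for i :: int
  have st: "s \<otimes> t = \<one>" using assms(3) tc sc by (simp add: m_comm)
  have powt: "t [^] n \<in> gA (int n)" for n :: nat
  proof (induction n)
    case (Suc n) then show ?case using ring_grading_mult[OF Suc assms(1)] by (simp add: add.commute)
  qed (simp add: one_degree_zero)
  have pows: "s [^] n \<in> gA (- int n)" for n :: nat
  proof (induction n)
    case (Suc n) then show ?case using ring_grading_mult[OF Suc assms(2)] by (simp add: algebra_simps)
  qed (simp add: one_degree_zero)
  have deg: "tp i \<in> gA i" for i
    using powt[of "nat i"] pows[of "nat (- i)"] unfolding tp_def by (cases "i \<ge> 0") auto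
  have tpc: "tp i \<in> carrier A" for i by (rule g.gr_closed[OF deg])
  have tp_nat: "tp (int n) = t [^] n" for n by (simp add: tp_def)
  have tp_neg: "tp (- int n) = s [^] n" for n by (cases "n = 0") (simp_all add: tp_def)
  have up: "t \<otimes> tp i = tp (i + 1)" for i
  proof (cases i)
    case (nonneg n)
    have "i + 1 = int (Suc n)" using nonneg by simp
    then have "tp (i + 1) = t [^] n \<otimes> t" by (simp only: tp_nat nat_pow_Suc)
    then show ?thesis using nonneg tc by (simp add: tp_nat m_comm)
  next
    \<comment> \<open>Here \<open>i = - int (Suc n)\<close>: one factor \<open>s\<close> cancels
      against \<open>t\<close> and the exponent \<open>- int n\<close> remains, which also covers
      the passage to exponent zero.\<close>
    case (neg n)
    have "i + 1 = - int n" using neg by simp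
    then have eq: "tp (i + 1) = s [^] n" "tp i = s [^] n \<otimes> s"
      unfolding neg by (simp_all only: tp_neg nat_pow_Suc)
    have "t \<otimes> (s [^] n \<otimes> s) = s [^] n \<otimes> (t \<otimes> s)"
      using tc sc by (simp add: m_lcomm)
    then show ?thesis unfolding eq using assms(3) sc by simp
  qed
  have down: "s \<otimes> tp i = tp (i - 1)" for i
  proof -
    have "s \<otimes> tp i = s \<otimes> (t \<otimes> tp (i - 1))" using up[of "i - 1"] by simp
    also have "\<dots> = tp (i - 1)" using tc sc st tpc m_assoc[of s t "tp (i - 1)"] by simp
    finally show ?thesis .
  qed
  have tp0: "tp 0 = \<one>" by (simp add: tp_def)
  have "tp i \<otimes> tp j = tp (i + j)" for i j
  proof (induction i rule: int_induct[where k = 0])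
    case base show ?case using tp0 tpc by simp
  next
    case (step1 i)
    have "tp (i + 1) \<otimes> tp j = t \<otimes> (tp i \<otimes> tp j)"
      using up[of i] tc tpc m_assoc by metis
    then show ?case using step1 up[of "i + j"] by (simp add: algebra_simps)
  next
    case (step2 i)
    have "tp (i - 1) \<otimes> tp j = s \<otimes> (tp i \<otimes> tp j)"
      using down[of i] sc tpc m_assoc by metis
    then show ?case using step2 down[of "i + j"] by (simp add: algebra_simps)
  qed
  then show ?thesis using deg tp0 by blast
qed

end

section \<open>Products of ideals with submodules, and the ring as a module over itself\<close>

lemma (in abelian_group) additive_subgroup_is_abelian_group:
  assumes "additive_subgroup H G"
  shows "abelian_group (G\<lparr>carrier := H\<rparr>)"
proof -
  interpret H: additive_subgroup H G by fact
  show ?thesis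
  proof (rule abelian_groupI)
    fix x assume "x \<in> carrier (G\<lparr>carrier := H\<rparr>)"
    then have "\<ominus> x \<in> H" "\<ominus> x \<oplus> x = \<zero>" by (simp_all add: l_neg)
    then show "\<exists>y\<in>carrier (G\<lparr>carrier := H\<rparr>). y \<oplus>\<^bsub>G\<lparr>carrier := H\<rparr>\<^esub> x = \<zero>\<^bsub>G\<lparr>carrier := H\<rparr>\<^esub>"
      by auto
  qed (simp_all add: a_assoc a_comm a_lcomm)
qed

text \<open>\<open>ideal_smult\<close> takes its second factor from the carrier, so the product of
  \<open>I\<close> with a submodule \<open>N\<close> is written by restricting the record to
  \<open>N\<close>. The inductive set is closed only under sums; negatives and scalar multiples are
  absorbed into the factor from \<open>I\<close>.\<close>

lemma (in module) ideal_smult_submodule: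
  assumes I: "ideal I R" and N: "submodule N R M"
  shows "submodule (ideal_smult (M\<lparr>carrier := N\<rparr>) I) R M" and "ideal_smult (M\<lparr>carrier := N\<rparr>) I \<subseteq> N"
proof -
  note NE = submoduleE[OF N]
  let ?P = "ideal_smult (M\<lparr>carrier := N\<rparr>) I"
  have Nc: "x \<in> carrier M" if "x \<in> N" for x using NE(1) that by (rule subsetD)
  have Ic: "a \<in> carrier R" if "a \<in> I" for a by (rule ideal.Icarr[OF I that])
  have P_prod: "a \<odot>\<^bsub>M\<^esub> m \<in> ?P" if "a \<in> I" "m \<in> N" for a m
    using ideal_smult.prod[of a I m "M\<lparr>carrier := N\<rparr>"] that by simp
  have P_sum: "x \<oplus>\<^bsub>M\<^esub> y \<in> ?P" if "x \<in> ?P" "y \<in> ?P" for x y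
    using ideal_smult.sum[OF that] by simp
  have PN: "x \<in> N" if "x \<in> ?P" for x
    using that
  proof induction
    case (prod a m) then show ?case using NE(4)[OF Ic] by simp
  next
    case (sum x y) then show ?case using NE(5) by simp
  qed
  then show "?P \<subseteq> N" by (rule subsetI)
  have neg: "\<ominus>\<^bsub>M\<^esub> x \<in> ?P" if "x \<in> ?P" for x
    using that
  proof induction
    case (prod a m)
    then have m: "m \<in> N" by simp
    have "\<ominus> a \<in> I" by (rule additive_subgroup.a_inv_closed[OF ideal.axioms(1)[OF I] prod(1)])
    then have "(\<ominus> a) \<odot>\<^bsub>M\<^esub> m \<in> ?P" using m by (rule P_prod)
    then show ?case using smult_l_minus[OF Ic[OF prod(1)] Nc[OF m]] by simp
  next
    case (sum x y)
    have "x \<in> carrier M" "y \<in> carrier M" using Nc[OF PN] sum(1,2) by auto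
    then show ?case using P_sum[OF sum(3,4)]
      by (simp add: M.minus_add)
  qed
  have smul: "r \<odot>\<^bsub>M\<^esub> x \<in> ?P" if r: "r \<in> carrier R" and x: "x \<in> ?P" for r x
    using x
  proof induction
    case (prod a m)
    then have m: "m \<in> N" by simp
    have "(r \<otimes> a) \<odot>\<^bsub>M\<^esub> m \<in> ?P"
      using ideal.I_l_closed[OF I prod(1) r] m by (rule P_prod)
    then show ?case using smult_assoc1[OF r Ic[OF prod(1)] Nc[OF m]] by simp
  next
    case (sum x y)
    have "x \<in> carrier M" "y \<in> carrier M" using Nc[OF PN] sum(1,2) by auto
    then show ?case using P_sum[OF sum(3,4)] r
      by (simp add: smult_r_distr)
  qed
  have z: "\<zero> \<in> I" by (rule additive_subgroup.zero_closed[OF ideal.axioms(1)[OF I]])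
  have zN: "\<zero>\<^bsub>M\<^esub> \<in> N" using subgroup.one_closed[OF submodule.axioms(1)[OF N]] by simp
  have "\<zero>\<^bsub>M\<^esub> \<in> ?P" using P_prod[OF z zN] by simp
  then show "submodule ?P R M"
    using PN Nc by (intro submoduleI) (auto intro: neg P_sum smul)
qed

text \<open>Turns ideals into submodules, so that the correspondence with degree zero, proved for
  modules, also serves ideals: it yields powers of \<open>I\<close> and the Noetherian property of
  the degree-zero ring.\<close>

definition self_module :: "('a, 'x) ring_scheme \<Rightarrow> ('a, 'a) module" where
  "self_module R = \<lparr>carrier = carrier R, monoid.mult = monoid.mult R, one = \<one>\<^bsub>R\<^esub>,
     zero = \<zero>\<^bsub>R\<^esub>, add = add R, module.smult = monoid.mult R\<rparr>"

lemma self_module_simps [simp]: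
  "carrier (self_module R) = carrier R" "\<zero>\<^bsub>self_module R\<^esub> = \<zero>\<^bsub>R\<^esub>"
  "add (self_module R) = add R" "module.smult (self_module R) = monoid.mult R"
  by (simp_all add: self_module_def)

lemma self_module_carrier_update: "self_module (R\<lparr>carrier := K\<rparr>) = (self_module R)\<lparr>carrier := K\<rparr>"
  by (simp add: self_module_def)

lemma hsum_self_module [simp]: "hsum (self_module R) gr = hsum R gr"
proof
  show "hsum (self_module R) gr \<subseteq> hsum R gr"
  proof
    fix x assume "x \<in> hsum (self_module R) gr" then show "x \<in> hsum R gr"
      by induction (auto intro: hsum.intros)
  qed
  show "hsum R gr \<subseteq> hsum (self_module R) gr"
  proof
    fix x assume "x \<in> hsum R gr" then show "x \<in> hsum (self_module R) gr"
    proof induction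
      case zero then show ?case using hsum.zero[of "self_module R"] by simp
    next
      case (add x i y) then show ?case using hsum.add[of x gr i y "self_module R"] by simp
    qed
  qed
qed

text \<open>Both sides are generated by the same products under the same addition. Reading
  \<open>J\<close> as a submodule on which \<open>I\<close> acts makes products of ideals a case of
  products of an ideal with a submodule.\<close>

lemma ideal_prod_eq_ideal_smult:
  "ideal_prod R I J = ideal_smult ((self_module R)\<lparr>carrier := J\<rparr>) I"
proof
  show "ideal_prod R I J \<subseteq> ideal_smult ((self_module R)\<lparr>carrier := J\<rparr>) I"
  proof
    fix x assume "x \<in> ideal_prod R I J"
    then show "x \<in> ideal_smult ((self_module R)\<lparr>carrier := J\<rparr>) I"
    proof induction
      case (prod i j)
      then show ?case using ideal_smult.prod[of i I j "(self_module R)\<lparr>carrier := J\<rparr>"] by simp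
    next
      case (sum x y) show ?case using ideal_smult.sum[OF sum(3,4)] by simp
    qed
  qed
  show "ideal_smult ((self_module R)\<lparr>carrier := J\<rparr>) I \<subseteq> ideal_prod R I J"
  proof
    fix x assume "x \<in> ideal_smult ((self_module R)\<lparr>carrier := J\<rparr>) I"
    then show "x \<in> ideal_prod R I J"
    proof induction
      case (prod i j)
      then show ?case using ideal_prod.prod[of i I j J R] by simp
    next
      case (sum x y) show ?case using ideal_prod.sum[OF sum(3,4)] by simp
    qed
  qed
qed

context cring
begin

lemma self_module_module: "module R (self_module R)"
proof (rule moduleI)
  show "abelian_group (self_module R)"
  proof (rule abelian_groupI)
    fix x assume "x \<in> carrier (self_module R)"
    then have "\<ominus> x \<in> carrier R" "\<ominus> x \<oplus> x = \<zero>" by (simp_all add: l_neg)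
    then show "\<exists>y\<in>carrier (self_module R). y \<oplus>\<^bsub>self_module R\<^esub> x = \<zero>\<^bsub>self_module R\<^esub>" by auto
  qed (simp_all add: a_assoc a_comm a_lcomm)
qed (simp_all add: l_distr r_distr m_assoc is_cring)

lemma ideal_iff_submodule: "ideal I R \<longleftrightarrow> submodule I R (self_module R)"
proof -
  have sg: "subgroup I (add_monoid (self_module R)) \<longleftrightarrow> subgroup I (add_monoid R)"
    unfolding subgroup_def m_inv_def by simp
  show ?thesis
  proof
    assume I: "ideal I R"
    show "submodule I R (self_module R)"
    proof (intro submodule.intro submodule_axioms.intro)
      show "subgroup I (add_monoid (self_module R))"
        by (rule iffD2[OF sg additive_subgroup.a_subgroup[OF ideal.axioms(1)[OF I]]])
    qed (simp add: ideal.I_l_closed[OF I])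
  next
    assume I: "submodule I R (self_module R)"
    have sub: "subgroup I (add_monoid R)" by (rule iffD1[OF sg submodule.axioms(1)[OF I]])
    have l: "x \<otimes> a \<in> I" if "a \<in> I" "x \<in> carrier R" for a x
      using submodule.smult_closed[OF I that(2,1)] by simp
    have "a \<in> carrier R" if "a \<in> I" for a using subgroup.mem_carrier[OF sub that] by simp
    then show "ideal I R"
      using l by (intro idealI ring_axioms sub) (simp_all add: m_comm)
  qed
qed

end

section \<open>Graded submodules and their degree-zero parts\<close>

text \<open>The family \<open>tp\<close> holds the integral powers of a homogeneous unit of degree
  one. Such a ring is the Laurent polynomial ring in \<open>tp 1\<close> over its degree-zero
  part.\<close>

locale graded_unit_ring = graded_ring +
  fixes tp :: "int \<Rightarrow> 'a"
  assumes tp_degree: "tp i \<in> gA i"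
    and tp_add: "tp i \<otimes> tp j = tp (i + j)"
    and tp_zero: "tp 0 = \<one>"

lemma (in graded_module) module_graded_group: "graded_group M gM"
  by (rule graded_group.intro[OF M.abelian_group_axioms graded_group_axioms.intro[OF module_grading]])

lemma (in graded_module) pregraded: "pregraded_module A M gM"
  by (rule pregraded_module.intro[OF module_axioms
        pregraded_module_axioms.intro[OF graded_group.gr_subgroup[OF module_graded_group]]])

lemma (in graded_ring) deg0_cring: "cring (deg0_ring A gA)"
proof -
  interpret g: graded_group A gA by (rule graded_group)
  have "subcring (gA 0) A"
  proof (rule subcringI')
    have neg: "\<ominus> x \<in> gA 0" if "x \<in> gA 0" for x
      by (rule additive_subgroup.a_inv_closed[OF g.gr_subgroup that])
    show "subring (gA 0) A"
      using ring_grading_mult[of _ 0 _ 0] additive_subgroup.a_closed[OF g.gr_subgroup, of _ 0]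
      by (intro subringI g.gr_subset one_degree_zero neg) simp_all
  qed
  then show ?thesis unfolding deg0_ring_def using subcring_iff[OF g.gr_subset] by blast
qed

locale graded_unit_module = graded_unit_ring A gA tp + graded_module A gA M gM
  for A :: "('a, 'x) ring_scheme" (structure) and gA tp
    and M :: "('a, 'b, 'y) module_scheme" (structure) and gM
begin

interpretation g: graded_group A gA by (rule graded_group)
interpretation gm: graded_group M gM by (rule module_graded_group)

abbreviation "A0 \<equiv> deg0_ring A gA"
abbreviation "M0 \<equiv> deg0_module M gM"

text \<open>The inverse of \<open>N \<mapsto> N \<inter> gM 0\<close>. For an
  \<open>A0\<close>-submodule of \<open>M0\<close> it is the \<open>A\<close>-submodule generated by
  \<open>N\<close>, since each graded piece of \<open>A\<close> is \<open>tp i\<close> times the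
  degree-zero part. Defined on all sets, it is monotone without side conditions, as
  \<open>chain_length_iso\<close> asks.\<close>

definition ext :: "'b set \<Rightarrow> 'b set" where
  "ext N = hsum M (\<lambda>i. (\<lambda>n. tp i \<odot>\<^bsub>M\<^esub> n) ` N)"

lemma tp_closed: "tp i \<in> carrier A"
  by (rule g.gr_closed[OF tp_degree])

lemma tp_inverse: "tp i \<otimes> tp (- i) = \<one>"
  using tp_add[of i "- i"] tp_zero by simp

lemma carrier_deg0: "carrier A0 = gA 0" "carrier M0 = gM 0"
  by (simp_all add: deg0_ring_def deg0_module_def)

lemma deg0_module: "module A0 M0"
proof (rule moduleI[OF deg0_cring])
  show "abelian_group M0"
    unfolding deg0_module_def by (rule M.additive_subgroup_is_abelian_group[OF gm.gr_subgroup])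
qed (use module_grading_smult[of _ 0 _ 0] g.gr_closed[of _ 0] gm.gr_closed[of _ 0] in
    \<open>simp_all add: deg0_ring_def deg0_module_def smult_l_distr smult_r_distr smult_assoc1\<close>)

lemma deg0_submodule_iff:
  "submodule N A0 M0 \<longleftrightarrow> additive_subgroup N M \<and> N \<subseteq> gM 0 \<and>
    (\<forall>a\<in>gA 0. \<forall>x\<in>N. a \<odot>\<^bsub>M\<^esub> x \<in> N)"
proof -
  have sg: "subgroup (gM 0) (add_monoid M)" by (rule additive_subgroup.a_subgroup[OF gm.gr_subgroup])
  have "subgroup N (add_monoid (M\<lparr>carrier := gM 0\<rparr>)) \<longleftrightarrow> subgroup N (add_monoid M) \<and> N \<subseteq> gM 0"
    using M.add.incl_subgroup[OF sg, of N] M.add.subgroup_incl[of N "gM 0"] sg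
      subgroup.subset[of N "add_monoid (M\<lparr>carrier := gM 0\<rparr>)"] by auto
  then show ?thesis
    unfolding submodule_def submodule_axioms_def deg0_module_def deg0_ring_def
      additive_subgroup_def by auto
qed

lemma ext_mono: "N \<subseteq> L \<Longrightarrow> ext N \<subseteq> ext L"
  unfolding ext_def by (rule hsum_mono) (rule image_mono)

lemma ext_gen_subgroup:
  assumes "additive_subgroup N M"
  shows "additive_subgroup ((\<lambda>n. tp i \<odot>\<^bsub>M\<^esub> n) ` N) M"
proof (intro additive_subgroupI M.add.subgroupI)
  interpret N: additive_subgroup N M by fact
  have Nc: "x \<in> carrier M" if "x \<in> N" for x using N.a_subset that by (rule subsetD)
  show "(\<lambda>n. tp i \<odot>\<^bsub>M\<^esub> n) ` N \<subseteq> carrier M" using tp_closed Nc by auto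
  show "(\<lambda>n. tp i \<odot>\<^bsub>M\<^esub> n) ` N \<noteq> {}" using N.zero_closed by blast
  fix x assume "x \<in> (\<lambda>n. tp i \<odot>\<^bsub>M\<^esub> n) ` N"
  then obtain n where n: "n \<in> N" "x = tp i \<odot>\<^bsub>M\<^esub> n" by (rule imageE)
  have "\<ominus>\<^bsub>M\<^esub> x = tp i \<odot>\<^bsub>M\<^esub> (\<ominus>\<^bsub>M\<^esub> n)" unfolding n(2) using smult_r_minus[OF tp_closed Nc[OF n(1)]] ..
  then show "\<ominus>\<^bsub>M\<^esub> x \<in> (\<lambda>n. tp i \<odot>\<^bsub>M\<^esub> n) ` N"
    using N.a_inv_closed[OF n(1)] by (rule image_eqI)
  fix y assume "y \<in> (\<lambda>n. tp i \<odot>\<^bsub>M\<^esub> n) ` N"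
  then obtain m where m: "m \<in> N" "y = tp i \<odot>\<^bsub>M\<^esub> m" by (rule imageE)
  have "x \<oplus>\<^bsub>M\<^esub> y = tp i \<odot>\<^bsub>M\<^esub> (n \<oplus>\<^bsub>M\<^esub> m)"
    unfolding n(2) m(2) using smult_r_distr[OF tp_closed Nc[OF n(1)] Nc[OF m(1)]] ..
  then show "x \<oplus>\<^bsub>M\<^esub> y \<in> (\<lambda>n. tp i \<odot>\<^bsub>M\<^esub> n) ` N"
    using N.a_closed[OF n(1) m(1)] by (rule image_eqI)
qed

lemma ext_additive_subgroup:
  assumes "additive_subgroup N M"
  shows "additive_subgroup (ext N) M"
  unfolding ext_def by (rule M.hsum_additive_subgroup) (rule ext_gen_subgroup[OF assms])

lemma ext_gen: "additive_subgroup N M \<Longrightarrow> n \<in> N \<Longrightarrow> tp i \<odot>\<^bsub>M\<^esub> n \<in> ext N"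
  unfolding ext_def
  by (rule M.hsum_homogeneous[of _ i]) (auto intro!: additive_subgroup.a_subset[OF ext_gen_subgroup])

text \<open>The element \<open>tp (- k) \<otimes> b\<close> has degree zero when \<open>b\<close> has degree \<open>k\<close>, which reduces
  products of homogeneous elements to products of elements of degree zero.\<close>

lemma ext_smult:
  assumes N: "additive_subgroup N M" and L: "additive_subgroup L M"
    and gr: "\<And>k. gr k \<subseteq> gA k"
    and mult: "\<And>k b n. \<lbrakk>b \<in> gr k; n \<in> N\<rbrakk> \<Longrightarrow> (tp (- k) \<otimes> b) \<odot>\<^bsub>M\<^esub> n \<in> L"
    and a: "a \<in> hsum A gr" and x: "x \<in> ext N"
  shows "a \<odot>\<^bsub>M\<^esub> x \<in> ext L"
proof -
  interpret L: additive_subgroup "ext L" M by (rule ext_additive_subgroup[OF L])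
  have ext_closed: "y \<in> carrier M" if "y \<in> ext N" for y
    by (rule subsetD[OF additive_subgroup.a_subset[OF ext_additive_subgroup[OF N]] that])
  have Nc: "n \<in> carrier M" if "n \<in> N" for n
    by (rule subsetD[OF additive_subgroup.a_subset[OF N] that])
  have hom: "b \<odot>\<^bsub>M\<^esub> x \<in> ext L" if b: "b \<in> gr k" for b k
  proof -
    have bc: "b \<in> carrier A" by (rule g.gr_closed[OF subsetD[OF gr b]])
    show ?thesis
      using x unfolding ext_def[of N]
    proof induction
      case zero show ?case using bc by simp
    next
      case (add y i z)
      then obtain n where n: "n \<in> N" "y = tp i \<odot>\<^bsub>M\<^esub> n" by blast
      have z: "z \<in> carrier M" by (rule ext_closed) (unfold ext_def, rule add(2))
      have eq: "b \<otimes> tp i = tp (k + i) \<otimes> (tp (- k) \<otimes> b)"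
        using m_assoc[OF tp_closed tp_closed bc, of "k + i" "- k"] m_comm[OF bc tp_closed, of i]
        by (simp add: tp_add)
      have "b \<odot>\<^bsub>M\<^esub> y = (b \<otimes> tp i) \<odot>\<^bsub>M\<^esub> n"
        unfolding n(2) by (rule smult_assoc1[OF bc tp_closed Nc[OF n(1)], symmetric])
      also have "\<dots> = tp (k + i) \<odot>\<^bsub>M\<^esub> ((tp (- k) \<otimes> b) \<odot>\<^bsub>M\<^esub> n)"
        unfolding eq by (rule smult_assoc1[OF tp_closed m_closed[OF tp_closed bc] Nc[OF n(1)]])
      finally have "b \<odot>\<^bsub>M\<^esub> y = tp (k + i) \<odot>\<^bsub>M\<^esub> ((tp (- k) \<otimes> b) \<odot>\<^bsub>M\<^esub> n)" .
      then have "b \<odot>\<^bsub>M\<^esub> y \<in> ext L" using ext_gen[OF L mult[OF b n(1)], of "k + i"] by simp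
      moreover have "y \<in> carrier M" unfolding n(2) using tp_closed Nc[OF n(1)] by simp
      ultimately show ?case using add(3) z bc by (simp add: smult_r_distr)
    qed
  qed
  show ?thesis
    using a
  proof induction
    case zero show ?case using ext_closed[OF x] by simp
  next
    case (add b k c)
    have b: "b \<in> carrier A" by (rule g.gr_closed[OF subsetD[OF gr add(1)]])
    have c: "c \<in> carrier A"
      unfolding g.carrier_eq_hsum by (rule subsetD[OF hsum_mono[OF gr] add(2)])
    show ?case using hom[OF add(1)] add(3) b c ext_closed[OF x] by (simp add: smult_l_distr)
  qed
qed

text \<open>A generator \<open>tp i\<close> times \<open>n\<close> has degree \<open>i\<close>, so
  the degree-zero component of an element of \<open>ext N\<close> keeps only summands with
  \<open>i = 0\<close>, which lie in \<open>N\<close> because \<open>tp 0 = \<one>\<close>.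
  Uniqueness of homogeneous decompositions in \<open>M\<close> enters here, through
  \<open>gm.component\<close>.\<close>

lemma ext_graded_submodule:
  assumes "submodule N A0 M0"
  shows "graded_submodule A M gM (ext N)" and "ext N \<inter> gM 0 = N"
proof -
  have N: "additive_subgroup N M" "N \<subseteq> gM 0" "\<And>a x. \<lbrakk>a \<in> gA 0; x \<in> N\<rbrakk> \<Longrightarrow> a \<odot>\<^bsub>M\<^esub> x \<in> N"
    using assms unfolding deg0_submodule_iff by blast+
  have sub: "submodule (ext N) A M"
  proof (intro submodule.intro submodule_axioms.intro)
    show "subgroup (ext N) (add_monoid M)"
      by (rule additive_subgroup.a_subgroup[OF ext_additive_subgroup[OF N(1)]])
    fix a x assume "a \<in> carrier A" and x: "x \<in> ext N"
    then have a: "a \<in> hsum A gA" using g.carrier_eq_hsum by simp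
    have deg: "tp (- k) \<otimes> b \<in> gA 0" if "b \<in> gA k" for k b
      using ring_grading_mult[OF tp_degree[of "- k"] that] by simp
    show "a \<odot>\<^bsub>M\<^esub> x \<in> ext N"
      by (rule ext_smult[OF N(1) N(1) subset_refl N(3)[OF deg] a x])
  qed
  have tpN: "tp i \<odot>\<^bsub>M\<^esub> n \<in> gM i" if "n \<in> N" for i n
    using module_grading_smult[OF tp_degree subsetD[OF N(2) that], of i] by simp
  have "ext N \<subseteq> hsum M (\<lambda>i. gM i \<inter> ext N)"
    unfolding ext_def[of N]
    by (rule hsum_mono) (use tpN ext_gen[OF N(1)] in \<open>auto simp: ext_def\<close>)
  then show "graded_submodule A M gM (ext N)"
    unfolding pregraded_module.graded_submodule_iff[OF pregraded] using sub by simp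
  have comp: "gm.component x 0 \<in> N" if "x \<in> ext N" for x
    using that unfolding ext_def
  proof induction
    case zero show ?case by (simp add: gm.component_zero additive_subgroup.zero_closed[OF N(1)])
  next
    case (add y i z)
    then obtain n where n: "n \<in> N" "y = tp i \<odot>\<^bsub>M\<^esub> n" by blast
    have y: "y \<in> gM i" using tpN[OF n(1)] n(2) by simp
    have yc: "y \<in> carrier M" by (rule gm.gr_closed[OF y])
    have "z \<in> ext N" unfolding ext_def by (rule add(2))
    then have z: "z \<in> carrier M" by (rule subsetD[OF additive_subgroup.a_subset[OF ext_additive_subgroup[OF N(1)]]])
    have "gm.component y 0 \<in> N"
    proof (cases "i = 0")
      case True
      then have "y = n" using n tp_zero gm.gr_closed[OF subsetD[OF N(2) n(1)]] by simp
      then show ?thesis using gm.component_homogeneous[OF y] True n(1) by simp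
    next
      case False
      then show ?thesis
        using gm.component_homogeneous[OF y] additive_subgroup.zero_closed[OF N(1)] by simp
    qed
    then show ?case
      unfolding gm.component_add[OF yc z] using add(3) by (rule additive_subgroup.a_closed[OF N(1)])
  qed
  show "ext N \<inter> gM 0 = N"
  proof
    show "ext N \<inter> gM 0 \<subseteq> N"
    proof
      fix x assume "x \<in> ext N \<inter> gM 0"
      then show "x \<in> N" using comp[of x] gm.component_homogeneous[of x 0 0] by simp
    qed
    show "N \<subseteq> ext N \<inter> gM 0"
    proof
      fix n assume n: "n \<in> N"
      have "n \<in> gM 0" by (rule subsetD[OF N(2) n])
      moreover have "tp 0 \<odot>\<^bsub>M\<^esub> n \<in> ext N" by (rule ext_gen[OF N(1) n])
      ultimately show "n \<in> ext N \<inter> gM 0" using tp_zero gm.gr_closed[of n 0] by simp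
    qed
  qed
qed

text \<open>A homogeneous \<open>x\<close> of degree \<open>i\<close> in \<open>N\<close> equals
  \<open>tp i\<close> times its shift by \<open>tp (- i)\<close>; the shift lies in \<open>N\<close>
  and has degree zero. Gradedness of \<open>N\<close> extends this from homogeneous elements to all
  of \<open>N\<close>.\<close>

lemma graded_submodule_deg0:
  assumes "graded_submodule A M gM N"
  shows "submodule (N \<inter> gM 0) A0 M0" and "ext (N \<inter> gM 0) = N"
proof -
  have N: "submodule N A M" and hN: "N \<subseteq> hsum M (\<lambda>i. gM i \<inter> N)"
    using assms unfolding pregraded_module.graded_submodule_iff[OF pregraded] by simp_all
  have sN: "additive_subgroup N M" by (rule additive_subgroupI[OF submodule.axioms(1)[OF N]])
  have sN0: "additive_subgroup (N \<inter> gM 0) M"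
    by (rule additive_subgroupI[OF M.add.subgroups_Inter_pair[OF
            additive_subgroup.a_subgroup[OF sN] additive_subgroup.a_subgroup[OF gm.gr_subgroup]]])
  have sm: "a \<odot>\<^bsub>M\<^esub> x \<in> N" if "a \<in> gA i" "x \<in> N" for a x i
    by (rule submodule.smult_closed[OF N g.gr_closed[OF that(1)] that(2)])
  show "submodule (N \<inter> gM 0) A0 M0"
    unfolding deg0_submodule_iff using sN0 sm module_grading_smult[of _ 0 _ 0] by simp
  show "ext (N \<inter> gM 0) = N"
  proof
    show "ext (N \<inter> gM 0) \<subseteq> N"
      unfolding ext_def by (rule M.hsum_subset[OF sN]) (use sm[OF tp_degree] in blast)
    have "gM i \<inter> N \<subseteq> (\<lambda>n. tp i \<odot>\<^bsub>M\<^esub> n) ` (N \<inter> gM 0)" for i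
    proof
      fix x assume x: "x \<in> gM i \<inter> N"
      then have xc: "x \<in> carrier M" using gm.gr_closed[of x i] by simp
      have "tp (- i) \<odot>\<^bsub>M\<^esub> x \<in> N \<inter> gM 0"
        using x sm[OF tp_degree[of "- i"]] module_grading_smult[OF tp_degree[of "- i"], of x i] by simp
      moreover have "x = tp i \<odot>\<^bsub>M\<^esub> (tp (- i) \<odot>\<^bsub>M\<^esub> x)"
        using smult_assoc1[OF tp_closed tp_closed xc, of i "- i"] tp_inverse[of i] xc by simp
      ultimately show "x \<in> (\<lambda>n. tp i \<odot>\<^bsub>M\<^esub> n) ` (N \<inter> gM 0)" by (rule rev_image_eqI)
    qed
    then have "hsum M (\<lambda>i. gM i \<inter> N) \<subseteq> ext (N \<inter> gM 0)" unfolding ext_def by (rule hsum_mono)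
    then show "N \<subseteq> ext (N \<inter> gM 0)" using hN by (rule subset_trans[rotated])
  qed
qed

lemma graded_submodule_carrier: "graded_submodule A M gM (carrier M)"
proof -
  have "carrier M \<subseteq> hsum M (\<lambda>i. gM i \<inter> carrier M)"
    using gm.carrier_eq_hsum hsum_mono[of gM "\<lambda>i. gM i \<inter> carrier M" M] gm.gr_subset by auto
  then show ?thesis
    unfolding pregraded_module.graded_submodule_iff[OF pregraded] using carrier_is_submodule by simp
qed

lemma chain_length_deg0:
  assumes N: "graded_submodule A M gM N"
  shows "chain_length (graded_submodule A M gM) N (carrier M)
    = chain_length (\<lambda>K. submodule K A0 M0) (N \<inter> gM 0) (gM 0)"
proof -
  have c: "carrier M \<inter> gM 0 = gM 0" using gm.gr_subset by auto
  have "chain_length (graded_submodule A M gM) N (carrier M)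
    = chain_length (\<lambda>K. submodule K A0 M0) (N \<inter> gM 0) (carrier M \<inter> gM 0)"
  proof (rule chain_length_iso[where g = ext and f = "\<lambda>K. K \<inter> gM 0"])
    show "mono (\<lambda>K. K \<inter> gM 0)" by (rule monoI) auto
    show "mono ext" by (rule monoI) (rule ext_mono)
    show "N \<subseteq> carrier M"
      by (rule submoduleE(1)[OF graded_submoduleD[OF N]])
  qed (simp_all add: graded_submodule_deg0 ext_graded_submodule graded_submodule_carrier N)
  then show ?thesis unfolding c .
qed

text \<open>One inclusion holds because \<open>tp i\<close> commutes past scalars from
  \<open>I\<close>. For the other, a homogeneous \<open>b\<close> in \<open>I\<close> of degree
  \<open>k\<close> is normalised to \<open>tp (- k) \<otimes> b\<close> in
  \<open>I \<inter> gA 0\<close>, and gradedness of \<open>I\<close> reduces to such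
  \<open>b\<close>. A general \<open>N\<close> is allowed so that both \<open>I M\<close> and
  products of ideals are covered.\<close>

lemma ext_ideal_smult:
  assumes I: "ideal I A" "I \<subseteq> hsum A (\<lambda>i. gA i \<inter> I)" "ideal (I \<inter> gA 0) A0"
    and N: "submodule N A0 M0"
  shows "ext (ideal_smult (M\<lparr>carrier := N\<rparr>) (I \<inter> gA 0)) = ideal_smult (M\<lparr>carrier := ext N\<rparr>) I"
    (is "ext ?L = ?R")
proof
  have sN: "additive_subgroup N M" using N unfolding deg0_submodule_iff by simp
  have eq: "M0\<lparr>carrier := N\<rparr> = M\<lparr>carrier := N\<rparr>" by (simp add: deg0_module_def)
  have L: "submodule ?L A0 M0"
    using module.ideal_smult_submodule(1)[OF deg0_module I(3) N] unfolding eq .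
  then have sL: "additive_subgroup ?L M" unfolding deg0_submodule_iff by simp
  have extN: "submodule (ext N) A M"
    by (rule graded_submoduleD[OF ext_graded_submodule(1)[OF N]])
  have R: "submodule ?R A M" by (rule ideal_smult_submodule(1)[OF I(1) extN])
  have sR: "additive_subgroup ?R M" by (rule additive_subgroupI[OF submodule.axioms(1)[OF R]])
  have Ic: "a \<in> carrier A" if "a \<in> I" for a by (rule ideal.Icarr[OF I(1) that])
  have Nc: "n \<in> carrier M" if "n \<in> N" for n
    by (rule subsetD[OF additive_subgroup.a_subset[OF sN] that])
  have Lc: "n \<in> carrier M" if "n \<in> ?L" for n
    by (rule subsetD[OF additive_subgroup.a_subset[OF sL] that])
  have "tp i \<odot>\<^bsub>M\<^esub> l \<in> ?R" if "l \<in> ?L" for i l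
    using that
  proof induction
    case (prod a n)
    then have a: "a \<in> I" and n: "n \<in> N" by simp_all
    have "a \<odot>\<^bsub>M\<^esub> (tp i \<odot>\<^bsub>M\<^esub> n) \<in> ?R"
      using ideal_smult.prod[OF a, of "tp i \<odot>\<^bsub>M\<^esub> n" "M\<lparr>carrier := ext N\<rparr>"] ext_gen[OF sN n] by simp
    moreover have "a \<odot>\<^bsub>M\<^esub> (tp i \<odot>\<^bsub>M\<^esub> n) = tp i \<odot>\<^bsub>M\<^esub> (a \<odot>\<^bsub>M\<^esub> n)"
      using smult_assoc1[OF Ic[OF a] tp_closed Nc[OF n], of i]
        smult_assoc1[OF tp_closed Ic[OF a] Nc[OF n], of i] m_comm[OF Ic[OF a] tp_closed, of i] by simp
    ultimately show ?case by simp
  next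
    case (sum x y)
    have "tp i \<odot>\<^bsub>M\<^esub> x \<oplus>\<^bsub>M\<^esub> tp i \<odot>\<^bsub>M\<^esub> y \<in> ?R"
      by (rule additive_subgroup.a_closed[OF sR sum(3,4)])
    then show ?case using Lc[OF sum(1)] Lc[OF sum(2)] tp_closed by (simp add: smult_r_distr)
  qed
  then have "(\<lambda>n. tp i \<odot>\<^bsub>M\<^esub> n) ` ?L \<subseteq> ?R" for i by (rule image_subsetI)
  then show "ext ?L \<subseteq> ?R" unfolding ext_def[of ?L] by (rule M.hsum_subset[OF sR])
  show "?R \<subseteq> ext ?L"
  proof
    fix x assume "x \<in> ?R"
    then show "x \<in> ext ?L"
    proof induction
      case (prod a m)
      have mult: "(tp (- k) \<otimes> b) \<odot>\<^bsub>M\<^esub> n \<in> ?L" if b: "b \<in> gA k \<inter> I" and n: "n \<in> N" for k b n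
      proof -
        have "tp (- k) \<otimes> b \<in> I \<inter> gA 0"
          using ring_grading_mult[OF tp_degree[of "- k"], of b k] b
            ideal.I_l_closed[OF I(1) _ tp_closed] by simp
        then show ?thesis using ideal_smult.prod[of "tp (- k) \<otimes> b" "I \<inter> gA 0" n "M\<lparr>carrier := N\<rparr>"] n by simp
      qed
      have "a \<odot>\<^bsub>M\<^esub> m \<in> ext ?L"
        by (rule ext_smult[of N ?L "\<lambda>i. gA i \<inter> I", OF sN sL _ mult subsetD[OF I(2) prod(1)]])
          (use prod(2) in simp_all)
      then show ?case by simp
    next
      case (sum x y)
      show ?case using additive_subgroup.a_closed[OF ext_additive_subgroup[OF sL] sum(3,4)] by simp
    qed
  qed
qed

end

section \<open>Finite length of quotients by powers of an ideal\<close>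

text \<open>Finite length without its value, suited to inductions that extend a chain by steps of
  unknown strictness.\<close>

definition fin_len :: "('b set \<Rightarrow> bool) \<Rightarrow> 'b set \<Rightarrow> 'b set \<Rightarrow> bool" where
  "fin_len S N L \<longleftrightarrow> (\<exists>n C. cover_chain S N L C n)"

lemma chain_length_finite_iff: "chain_length S N L < \<infinity> \<longleftrightarrow> fin_len S N L"
  unfolding chain_length_def fin_len_def by simp

lemma fin_len_refl: "S N \<Longrightarrow> fin_len S N N"
  unfolding fin_len_def cover_chain_def by (intro exI[of _ 0] exI[of _ "\<lambda>_. N"]) simp

text \<open>The inclusion of \<open>K\<close> in \<open>L\<close> may be an equality, because the
  image of a composition series under multiplication by a ring element can repeat terms; a repeated
  term leaves the chain unchanged.\<close>

lemma fin_len_extend: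
  assumes NK: "fin_len S N K" and L: "S L" "K \<subseteq> L"
    and cov: "\<And>X. \<lbrakk>S X; K \<subseteq> X; X \<subseteq> L\<rbrakk> \<Longrightarrow> X = K \<or> X = L"
  shows "fin_len S N L"
proof (cases "K = L")
  case True then show ?thesis using NK by simp
next
  case False
  obtain n C where C: "C 0 = N" "C n = K" "\<And>i. i \<le> n \<Longrightarrow> S (C i)"
    "\<And>i. i < n \<Longrightarrow> C i \<subset> C (Suc i) \<and>
      (\<forall>X. S X \<and> C i \<subseteq> X \<and> X \<subseteq> C (Suc i) \<longrightarrow> X = C i \<or> X = C (Suc i))"
    using NK unfolding fin_len_def cover_chain_def by auto
  define D where "D i = (if i \<le> n then C i else L)" for i
  have "cover_chain S N L D (Suc n)"
    unfolding cover_chain_def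
  proof (intro conjI allI impI)
    show "D 0 = N" "D (Suc n) = L" using C(1) by (simp_all add: D_def)
    show "S (D i)" for i using C(3) L(1) by (simp add: D_def)
    fix i assume "i < Suc n"
    then consider "i < n" | "i = n" by linarith
    then have "D i \<subset> D (Suc i) \<and>
      (\<forall>X. S X \<and> D i \<subseteq> X \<and> X \<subseteq> D (Suc i) \<longrightarrow> X = D i \<or> X = D (Suc i))"
    proof cases
      case 1
      then have "D i = C i" "D (Suc i) = C (Suc i)" by (simp_all add: D_def)
      then show ?thesis using C(4)[OF 1] by simp
    next
      case 2
      then have "D i = K" "D (Suc i) = L" using C(2) by (simp_all add: D_def)
      then show ?thesis using cov L(2) False by auto
    qed
    then show "D i \<subset> D (Suc i)"
      and "S X \<and> D i \<subseteq> X \<and> X \<subseteq> D (Suc i) \<Longrightarrow> X = D i \<or> X = D (Suc i)" for X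
      by (rule conjunct1) (use \<open>D i \<subset> D (Suc i) \<and> _\<close> in blast)
  qed
  then show ?thesis unfolding fin_len_def by blast
qed

context module
begin

text \<open>The sum \<open>X + a K\<close>. With \<open>K\<close> running through a composition
  series these sums fill the gap between \<open>X\<close> and \<open>X + a M\<close>.\<close>

definition add_smult :: "'c set \<Rightarrow> 'a \<Rightarrow> 'c set \<Rightarrow> 'c set" where
  "add_smult X a K = (\<lambda>(x, m). x \<oplus>\<^bsub>M\<^esub> a \<odot>\<^bsub>M\<^esub> m) ` (X \<times> K)"

lemma add_smultI: "x \<in> X \<Longrightarrow> m \<in> K \<Longrightarrow> x \<oplus>\<^bsub>M\<^esub> a \<odot>\<^bsub>M\<^esub> m \<in> add_smult X a K"
  unfolding add_smult_def by (rule rev_image_eqI[of "(x, m)"]) simp_all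

lemma add_smultE:
  assumes "y \<in> add_smult X a K"
  obtains x m where "x \<in> X" "m \<in> K" "y = x \<oplus>\<^bsub>M\<^esub> a \<odot>\<^bsub>M\<^esub> m"
  using assms unfolding add_smult_def by auto

lemma submodule_zero: "submodule N R M \<Longrightarrow> \<zero>\<^bsub>M\<^esub> \<in> N"
  using subgroup.one_closed[OF submodule.axioms(1), of N R M] by simp

lemma submodule_mem: "submodule N R M \<Longrightarrow> x \<in> N \<Longrightarrow> x \<in> carrier M"
  by (rule subsetD[OF submoduleE(1)])

lemma add_smult_submodule:
  assumes X: "submodule X R M" and a: "a \<in> carrier R" and K: "submodule K R M"
  shows "submodule (add_smult X a K) R M"
proof (rule submoduleI)
  note XE = submoduleE[OF X] and KE = submoduleE[OF K]
  note Xc = submodule_mem[OF X] and Kc = submodule_mem[OF K]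
  show "add_smult X a K \<subseteq> carrier M"
  proof
    fix y assume "y \<in> add_smult X a K"
    then show "y \<in> carrier M" by (rule add_smultE) (simp add: a Xc Kc)
  qed
  show "\<zero>\<^bsub>M\<^esub> \<in> add_smult X a K"
    using add_smultI[OF submodule_zero[OF X] submodule_zero[OF K], of a] a by simp
  show "\<ominus>\<^bsub>M\<^esub> y \<in> add_smult X a K" if y: "y \<in> add_smult X a K" for y
  proof -
    obtain x m where xm: "x \<in> X" "m \<in> K" "y = x \<oplus>\<^bsub>M\<^esub> a \<odot>\<^bsub>M\<^esub> m"
      using y by (rule add_smultE)
    have "\<ominus>\<^bsub>M\<^esub> y = \<ominus>\<^bsub>M\<^esub> x \<oplus>\<^bsub>M\<^esub> a \<odot>\<^bsub>M\<^esub> (\<ominus>\<^bsub>M\<^esub> m)"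
      unfolding xm(3) using M.minus_add[OF Xc[OF xm(1)] smult_closed[OF a Kc[OF xm(2)]]]
        smult_r_minus[OF a Kc[OF xm(2)]] by simp
    then show ?thesis using add_smultI[OF XE(3)[OF xm(1)] KE(3)[OF xm(2)], of a] by simp
  qed
  show "y \<oplus>\<^bsub>M\<^esub> z \<in> add_smult X a K" if y: "y \<in> add_smult X a K" and z: "z \<in> add_smult X a K" for y z
  proof -
    obtain x m where xm: "x \<in> X" "m \<in> K" "y = x \<oplus>\<^bsub>M\<^esub> a \<odot>\<^bsub>M\<^esub> m"
      using y by (rule add_smultE)
    obtain x' m' where xm': "x' \<in> X" "m' \<in> K" "z = x' \<oplus>\<^bsub>M\<^esub> a \<odot>\<^bsub>M\<^esub> m'" using z by (rule add_smultE)
    have "y \<oplus>\<^bsub>M\<^esub> z = (x \<oplus>\<^bsub>M\<^esub> x') \<oplus>\<^bsub>M\<^esub> a \<odot>\<^bsub>M\<^esub> (m \<oplus>\<^bsub>M\<^esub> m')"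
      unfolding xm(3) xm'(3) using a Xc[OF xm(1)] Xc[OF xm'(1)] Kc[OF xm(2)] Kc[OF xm'(2)]
      by (simp add: smult_r_distr M.a_assoc M.a_lcomm)
    then show ?thesis
      using add_smultI[OF XE(5)[OF xm(1) xm'(1)] KE(5)[OF xm(2) xm'(2)], of a] by simp
  qed
  show "r \<odot>\<^bsub>M\<^esub> y \<in> add_smult X a K" if r: "r \<in> carrier R" and y: "y \<in> add_smult X a K" for r y
  proof -
    obtain x m where xm: "x \<in> X" "m \<in> K" "y = x \<oplus>\<^bsub>M\<^esub> a \<odot>\<^bsub>M\<^esub> m"
      using y by (rule add_smultE)
    have "r \<odot>\<^bsub>M\<^esub> (a \<odot>\<^bsub>M\<^esub> m) = a \<odot>\<^bsub>M\<^esub> (r \<odot>\<^bsub>M\<^esub> m)"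
      using smult_assoc1[OF r a Kc[OF xm(2)]] smult_assoc1[OF a r Kc[OF xm(2)]] R.m_comm[OF r a] by simp
    then have "r \<odot>\<^bsub>M\<^esub> y = r \<odot>\<^bsub>M\<^esub> x \<oplus>\<^bsub>M\<^esub> a \<odot>\<^bsub>M\<^esub> (r \<odot>\<^bsub>M\<^esub> m)"
      unfolding xm(3) using smult_r_distr[OF r Xc[OF xm(1)] smult_closed[OF a Kc[OF xm(2)]]] by simp
    then show ?thesis using add_smultI[OF XE(4)[OF r xm(1)] KE(4)[OF r xm(2)], of a] by simp
  qed
qed

text \<open>Multiplication by \<open>a\<close> induces a surjection from \<open>M / N\<close> onto \<open>(X + a M) / X\<close>, so the
  image of a composition series is a chain whose steps are covers or equalities.\<close>

lemma fin_len_add_smult: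
  assumes len: "fin_len (\<lambda>K. submodule K R M) N (carrier M)"
    and X: "submodule X R M" and a: "a \<in> carrier R" and aN: "\<And>m. m \<in> N \<Longrightarrow> a \<odot>\<^bsub>M\<^esub> m \<in> X"
    and X0: "fin_len (\<lambda>K. submodule K R M) X0 X"
  shows "fin_len (\<lambda>K. submodule K R M) X0 (add_smult X a (carrier M))"
proof -
  obtain n C where C: "C 0 = N" "C n = carrier M" "\<And>i. i \<le> n \<Longrightarrow> submodule (C i) R M"
    "\<And>i. i < n \<Longrightarrow> C i \<subset> C (Suc i) \<and>
      (\<forall>K. submodule K R M \<and> C i \<subseteq> K \<and> K \<subseteq> C (Suc i) \<longrightarrow> K = C i \<or> K = C (Suc i))"
    using len unfolding fin_len_def cover_chain_def by auto
  note XE = submoduleE[OF X] and Xc = submodule_mem[OF X]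
  have sub: "X \<subseteq> add_smult X a K" if K: "submodule K R M" for K
  proof
    fix x assume x: "x \<in> X"
    then show "x \<in> add_smult X a K"
      using add_smultI[OF x submodule_zero[OF K], of a] a Xc[OF x] by simp
  qed
  have "fin_len (\<lambda>K. submodule K R M) X0 (add_smult X a (C i))" if "i \<le> n" for i
    using that
  proof (induction i)
    case 0
    \<comment> \<open>The series starts at \<open>C 0 = N\<close>, which \<open>a\<close> sends into
      \<open>X\<close>, so nothing new is added at the bottom.\<close>
    have "add_smult X a (C 0) \<subseteq> X"
    proof
      fix y assume "y \<in> add_smult X a (C 0)"
      then show "y \<in> X" by (rule add_smultE) (simp add: C(1) aN XE(5))
    qed
    then have "add_smult X a (C 0) = X" using sub[OF C(3)[of 0]] by auto
    then show ?case using X0 by simp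
  next
    case (Suc i)
    have i: "i \<le> n" "i < n" using Suc(2) by simp_all
    note Ci = C(3)[OF i(1)] and CS = C(3)[OF Suc(2)]
    note KE = submoduleE[OF CS] and Kc = submodule_mem[OF CS]
    show ?case
    proof (rule fin_len_extend[OF Suc(1)[OF i(1)]])
      show "submodule (add_smult X a (C (Suc i))) R M" by (rule add_smult_submodule[OF X a CS])
      show "add_smult X a (C i) \<subseteq> add_smult X a (C (Suc i))"
        unfolding add_smult_def using C(4)[OF i(2)] by (intro image_mono Sigma_mono) auto
      fix Z assume Z: "submodule Z R M"
        and lo: "add_smult X a (C i) \<subseteq> Z" and hi: "Z \<subseteq> add_smult X a (C (Suc i))"
      note ZE = submoduleE[OF Z] and Zc = submodule_mem[OF Z]
      have XZ: "x \<in> Z" if "x \<in> X" for x by (rule subsetD[OF lo subsetD[OF sub[OF Ci] that]])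
      \<comment> \<open>A submodule \<open>Z\<close> between consecutive sums is tested on the
        elements of \<open>C (Suc i)\<close> that \<open>a\<close> sends into \<open>Z\<close>. They
        form a submodule between \<open>C i\<close> and \<open>C (Suc i)\<close>, and the two values
        the cover allows force \<open>Z\<close> to one end or the other.\<close>
      let ?K = "{m \<in> C (Suc i). a \<odot>\<^bsub>M\<^esub> m \<in> Z}"
      have "submodule ?K R M"
      proof (rule submoduleI)
        show "?K \<subseteq> carrier M" using KE(1) by auto
        show "\<zero>\<^bsub>M\<^esub> \<in> ?K" using submodule_zero[OF CS] submodule_zero[OF Z] a by simp
        show "\<ominus>\<^bsub>M\<^esub> m \<in> ?K" if "m \<in> ?K" for m
          using that KE(3)[of m] ZE(3)[of "a \<odot>\<^bsub>M\<^esub> m"] smult_r_minus[OF a Kc[of m]] by simp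
        show "m \<oplus>\<^bsub>M\<^esub> k \<in> ?K" if "m \<in> ?K" "k \<in> ?K" for m k
          using that KE(5)[of m k] ZE(5)[of "a \<odot>\<^bsub>M\<^esub> m" "a \<odot>\<^bsub>M\<^esub> k"] smult_r_distr[OF a Kc[of m] Kc[of k]] by simp
        show "r \<odot>\<^bsub>M\<^esub> m \<in> ?K" if r: "r \<in> carrier R" and m: "m \<in> ?K" for r m
        proof -
          have mC: "m \<in> C (Suc i)" using m by simp
          have "a \<odot>\<^bsub>M\<^esub> (r \<odot>\<^bsub>M\<^esub> m) = r \<odot>\<^bsub>M\<^esub> (a \<odot>\<^bsub>M\<^esub> m)"
            using smult_assoc1[OF r a Kc[OF mC]] smult_assoc1[OF a r Kc[OF mC]] R.m_comm[OF r a] by simp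
          then show ?thesis using m KE(4)[OF r mC] ZE(4)[OF r, of "a \<odot>\<^bsub>M\<^esub> m"] by simp
        qed
      qed
      moreover have "C i \<subseteq> ?K"
      proof
        fix m assume m: "m \<in> C i"
        have "\<zero>\<^bsub>M\<^esub> \<oplus>\<^bsub>M\<^esub> a \<odot>\<^bsub>M\<^esub> m \<in> Z" by (rule subsetD[OF lo add_smultI[OF submodule_zero[OF X] m]])
        then show "m \<in> ?K" using m C(4)[OF i(2)] a submodule_mem[OF Ci m] by auto
      qed
      moreover have "?K \<subseteq> C (Suc i)" by auto
      ultimately have "?K = C i \<or> ?K = C (Suc i)" using C(4)[OF i(2)] by simp
      then show "Z = add_smult X a (C i) \<or> Z = add_smult X a (C (Suc i))"
      proof
        assume K: "?K = C i"
        have "Z \<subseteq> add_smult X a (C i)"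
        proof
          fix z assume z: "z \<in> Z"
          obtain x m where xm: "x \<in> X" "m \<in> C (Suc i)" "z = x \<oplus>\<^bsub>M\<^esub> a \<odot>\<^bsub>M\<^esub> m"
            using subsetD[OF hi z] by (rule add_smultE)
          have am: "a \<odot>\<^bsub>M\<^esub> m \<in> carrier M" by (rule smult_closed[OF a Kc[OF xm(2)]])
          \<comment> \<open>Since \<open>x\<close> lies in \<open>X\<close>, hence in
            \<open>Z\<close>, subtracting it from \<open>z\<close> isolates the multiple of
            \<open>a\<close> and places \<open>m\<close> in \<open>?K\<close>.\<close>
          have "\<ominus>\<^bsub>M\<^esub> x \<oplus>\<^bsub>M\<^esub> z \<in> Z" by (rule ZE(5)[OF ZE(3)[OF XZ[OF xm(1)]] z])
          then have "a \<odot>\<^bsub>M\<^esub> m \<in> Z" unfolding xm(3) using Xc[OF xm(1)] am by (simp add: M.r_neg1)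
          then have "m \<in> C i" using xm(2) K by auto
          then show "z \<in> add_smult X a (C i)" unfolding xm(3) by (rule add_smultI[OF xm(1)])
        qed
        then show ?thesis using lo by auto
      next
        assume K: "?K = C (Suc i)"
        have "add_smult X a (C (Suc i)) \<subseteq> Z"
        proof
          fix z assume "z \<in> add_smult X a (C (Suc i))"
          then obtain x m where xm: "x \<in> X" "m \<in> C (Suc i)" "z = x \<oplus>\<^bsub>M\<^esub> a \<odot>\<^bsub>M\<^esub> m"
            by (rule add_smultE)
          have "a \<odot>\<^bsub>M\<^esub> m \<in> Z" using xm(2) K by auto
          then show "z \<in> Z" unfolding xm(3) by (rule ZE(5)[OF XZ[OF xm(1)]])
        qed
        then show ?thesis using hi by auto
      qed
    qed
  qed
  then show ?thesis using C(2) by (metis order_refl)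
qed

lemma ideal_smult_carrier_submodule:
  assumes "ideal I R"
  shows "submodule (ideal_smult M I) R M"
  using ideal_smult_submodule(1)[OF assms carrier_is_submodule] by simp

text \<open>An element \<open>a\<close> of \<open>J\<close> sends \<open>I M\<close> into
  \<open>J I M\<close>, so for \<open>X\<close> above \<open>J I M\<close> multiplication by
  \<open>a\<close> maps \<open>M / I M\<close> onto the quotient of \<open>X + a M\<close> by
  \<open>X\<close>. Adding the generators of \<open>J\<close> one at a time climbs from
  \<open>J I M\<close> to \<open>J M\<close>. The lower end \<open>X0\<close> is left free so that
  such climbs can be stacked.\<close>

lemma fin_len_ideal_step:
  assumes I: "ideal I R" and J: "ideal J R"
    and S: "finite S" "S \<subseteq> carrier R" "J = genideal R S"
    and len: "fin_len (\<lambda>K. submodule K R M) (ideal_smult M I) (carrier M)"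
    and X0: "fin_len (\<lambda>K. submodule K R M) X0 (ideal_smult M (ideal_prod R J I))"
  shows "fin_len (\<lambda>K. submodule K R M) X0 (ideal_smult M J)"
proof -
  let ?JI = "ideal_smult M (ideal_prod R J I)" and ?J = "ideal_smult M J"
  have JI: "ideal (ideal_prod R J I) R" by (rule R.ideal_prod_is_ideal[OF J I])
  have sJI: "submodule ?JI R M" and sJ: "submodule ?J R M" and sI: "submodule (ideal_smult M I) R M"
    by (rule ideal_smult_carrier_submodule, fact)+
  have SJ: "S \<subseteq> J" unfolding S(3) by (rule R.genideal_self[OF S(2)])
  have Jc: "a \<in> carrier R" if "a \<in> J" for a by (rule ideal.Icarr[OF J that])
  have Ic: "a \<in> carrier R" if "a \<in> I" for a by (rule ideal.Icarr[OF I that])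
  have aI: "a \<odot>\<^bsub>M\<^esub> m \<in> ?JI" if a: "a \<in> J" and m: "m \<in> ideal_smult M I" for a m
    using m
  proof induction
    case (prod b m)
    have "a \<otimes> b \<in> ideal_prod R J I" by (rule ideal_prod.prod[OF a prod(1)])
    then have "(a \<otimes> b) \<odot>\<^bsub>M\<^esub> m \<in> ?JI" using prod(2) by (rule ideal_smult.prod)
    then show ?case using smult_assoc1[OF Jc[OF a] Ic[OF prod(1)] prod(2)] by simp
  next
    case (sum x y)
    then show ?case
      using smult_r_distr[OF Jc[OF a] submodule_mem[OF sI] submodule_mem[OF sI], of x y]
        ideal_smult.sum[OF sum(3,4)] by simp
  qed
  have "?JI \<subseteq> ?J"
  proof
    fix x assume "x \<in> ?JI"
    then show "x \<in> ?J"
    proof induction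
      case (prod a m)
      have "a \<in> J" using R.ideal_prod_inter[OF J I] prod(1) by auto
      then show ?case using prod(2) by (rule ideal_smult.prod)
    next
      case (sum x y) show ?case by (rule ideal_smult.sum[OF sum(3,4)])
    qed
  qed
  \<comment> \<open>\<open>X\<close> is the part of \<open>J M\<close> reached after the elements of
    \<open>T\<close> have been processed.\<close>
  have "\<exists>X. submodule X R M \<and> ?JI \<subseteq> X \<and> X \<subseteq> ?J \<and> fin_len (\<lambda>K. submodule K R M) X0 X \<and>
      (\<forall>a\<in>T. \<forall>m\<in>carrier M. a \<odot>\<^bsub>M\<^esub> m \<in> X)" if "finite T" "T \<subseteq> J" for T
    using that
  proof induction
    case empty
    show ?case using sJI X0 \<open>?JI \<subseteq> ?J\<close> by (intro exI[of _ ?JI]) simp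
  next
    case (insert a T)
    then obtain X where X: "submodule X R M" "?JI \<subseteq> X" "X \<subseteq> ?J" "fin_len (\<lambda>K. submodule K R M) X0 X"
      and TX: "\<forall>b\<in>T. \<forall>m\<in>carrier M. b \<odot>\<^bsub>M\<^esub> m \<in> X" by auto
    have a: "a \<in> J" using insert by simp
    note Xc = submodule_mem[OF X(1)]
    let ?Y = "add_smult X a (carrier M)"
    have XY: "X \<subseteq> ?Y"
    proof
      fix x assume x: "x \<in> X"
      then show "x \<in> ?Y" using add_smultI[OF x M.zero_closed, of a] Jc[OF a] Xc[OF x] by simp
    qed
    have "a \<odot>\<^bsub>M\<^esub> m \<in> ?Y" if "m \<in> carrier M" for m
      using add_smultI[OF submodule_zero[OF X(1)] that, of a] that Jc[OF a] by simp
    then have gen: "\<forall>b\<in>insert a T. \<forall>m\<in>carrier M. b \<odot>\<^bsub>M\<^esub> m \<in> ?Y" using TX XY by auto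
    have "submodule ?Y R M" by (rule add_smult_submodule[OF X(1) Jc[OF a] carrier_is_submodule])
    moreover have "?JI \<subseteq> ?Y" using X(2) XY by (rule subset_trans)
    moreover have "?Y \<subseteq> ?J"
    proof
      fix y assume "y \<in> ?Y"
      then obtain x m where xm: "x \<in> X" "m \<in> carrier M" "y = x \<oplus>\<^bsub>M\<^esub> a \<odot>\<^bsub>M\<^esub> m" by (rule add_smultE)
      show "y \<in> ?J"
        unfolding xm(3) by (rule ideal_smult.sum[OF subsetD[OF X(3) xm(1)] ideal_smult.prod[OF a xm(2)]])
    qed
    moreover have "fin_len (\<lambda>K. submodule K R M) X0 ?Y"
      by (rule fin_len_add_smult[OF len X(1) Jc[OF a] subsetD[OF X(2) aI[OF a]] X(4)])
    ultimately show ?case using gen by (intro exI[of _ ?Y]) simp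
  qed
  from this[OF S(1) SJ] obtain X where X: "submodule X R M" "X \<subseteq> ?J"
    "fin_len (\<lambda>K. submodule K R M) X0 X" and SX: "\<forall>a\<in>S. \<forall>m\<in>carrier M. a \<odot>\<^bsub>M\<^esub> m \<in> X" by auto
  note XE = submoduleE[OF X(1)]
  \<comment> \<open>The colon ideal of \<open>X\<close> and \<open>M\<close>: it contains the
    generators \<open>S\<close>, hence all of \<open>J\<close>, which forces \<open>X\<close> to be
    the whole of \<open>J M\<close>.\<close>
  let ?T = "{a \<in> carrier R. \<forall>m\<in>carrier M. a \<odot>\<^bsub>M\<^esub> m \<in> X}"
  have "ideal ?T R"
  proof (rule idealI[OF R.ring_axioms])
    show "subgroup ?T (add_monoid R)"
    proof (rule R.add.subgroupI)
      show "?T \<subseteq> carrier R" by auto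
      have "\<zero> \<in> ?T" using submodule_zero[OF X(1)] by simp
      then show "?T \<noteq> {}" by blast
      show "\<ominus> b \<in> ?T" if "b \<in> ?T" for b using that XE(3) by (simp add: smult_l_minus)
      show "b \<oplus> c \<in> ?T" if "b \<in> ?T" "c \<in> ?T" for b c
        using that XE(5) by (simp add: smult_l_distr)
    qed
    fix b x assume bx: "b \<in> ?T" "x \<in> carrier R"
    then show "x \<otimes> b \<in> ?T" using XE(4) by (simp add: smult_assoc1)
    then show "b \<otimes> x \<in> ?T" using bx by (simp add: R.m_comm)
  qed
  moreover have "S \<subseteq> ?T" using S(2) SX by auto
  ultimately have JT: "J \<subseteq> ?T" unfolding S(3) by (rule R.genideal_minimal)
  have "?J \<subseteq> X"
  proof
    fix x assume "x \<in> ?J"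
    then show "x \<in> X"
    proof induction
      case (prod a m) then show ?case using JT by auto
    next
      case (sum x y) show ?case by (rule XE(5)[OF sum(3,4)])
    qed
  qed
  then have "X = ?J" using X(2) by (rule subset_antisym[rotated])
  then show ?thesis using X(3) by simp
qed

lemma ideals_set_pow:
  "I [^]\<^bsub>ideals_set R\<^esub> (0::nat) = carrier R"
  "I [^]\<^bsub>ideals_set R\<^esub> Suc n = ideal_prod R (I [^]\<^bsub>ideals_set R\<^esub> n) I"
  by (simp_all add: nat_pow_def ideals_set_def)

end

lemma (in cring) ideal_pow_ideal:
  assumes "ideal I R"
  shows "ideal (I [^]\<^bsub>ideals_set R\<^esub> (n::nat)) R"
proof (induction n)
  case 0 show ?case by (simp add: nat_pow_def ideals_set_def oneideal)
next
  case (Suc n) then show ?case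
    using ideal_prod_is_ideal[OF Suc assms] by (simp add: nat_pow_def ideals_set_def)
qed

text \<open>The lower end stays at the product of \<open>M\<close> with the \<open>n\<close>-th
  power while the exponent at the upper end decreases from \<open>n\<close> to \<open>0\<close>.
  Each stage is \<open>fin_len_ideal_step\<close> for a power of \<open>I\<close>, whose finite
  generating set comes from the Noetherian property.\<close>

lemma (in module) fin_len_ideal_pow:
  assumes noeth: "noetherian_ring R" and I: "ideal I R"
    and len: "fin_len (\<lambda>K. submodule K R M) (ideal_smult M I) (carrier M)"
  shows "fin_len (\<lambda>K. submodule K R M) (ideal_smult M (I [^]\<^bsub>ideals_set R\<^esub> (n::nat))) (carrier M)"
proof -
  let ?p = "\<lambda>k::nat. I [^]\<^bsub>ideals_set R\<^esub> k"
  note p = R.ideal_pow_ideal[OF I]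
  have "fin_len (\<lambda>K. submodule K R M) (ideal_smult M (?p n)) (ideal_smult M (?p (n - j)))"
    if "j \<le> n" for j
    using that
  proof (induction j)
    case 0
    show ?case using fin_len_refl[of "\<lambda>K. submodule K R M", OF ideal_smult_carrier_submodule[OF p]] by simp
  next
    case (Suc j)
    obtain S where S: "S \<subseteq> carrier R" "finite S" "?p (n - Suc j) = genideal R S"
      using noetherian_ring.finetely_gen[OF noeth p[of "n - Suc j"]] by auto
    have "n - j = Suc (n - Suc j)" using Suc(2) by simp
    then have "?p (n - j) = ideal_prod R (?p (n - Suc j)) I" using ideals_set_pow(2) by simp
    then show ?case
      using fin_len_ideal_step[OF I p S(2,1,3) len] Suc by simp
  qed
  \<comment> \<open>At \<open>j = n\<close> the exponent is zero and the power is the unit ideal,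
    whose product with \<open>M\<close> is \<open>M\<close>.\<close>
  from this[of n] have "fin_len (\<lambda>K. submodule K R M) (ideal_smult M (?p n)) (ideal_smult M (carrier R))"
    using ideals_set_pow(1) by simp
  moreover have "ideal_smult M (carrier R) = carrier M"
  proof
    show "ideal_smult M (carrier R) \<subseteq> carrier M"
      by (rule submoduleE(1)[OF ideal_smult_carrier_submodule[OF R.oneideal]])
    show "carrier M \<subseteq> ideal_smult M (carrier R)"
    proof
      fix x assume x: "x \<in> carrier M"
      then show "x \<in> ideal_smult M (carrier R)" using ideal_smult.prod[OF R.one_closed x] by simp
    qed
  qed
  ultimately show ?thesis by simp
qed

section \<open>Powers of ideals and the main theorem\<close>

lemma hom_decomp_self_module [simp]: "hom_decomp (self_module R) = hom_decomp R"
  by (simp add: fun_eq_iff hom_decomp_def finsum_def finprod_def)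

lemma additive_subgroup_self_module: "additive_subgroup H R \<Longrightarrow> additive_subgroup H (self_module R)"
  unfolding additive_subgroup_def subgroup_def m_inv_def by simp

lemma deg0_self_module: "deg0_module (self_module A) gA = self_module (deg0_ring A gA)"
  by (simp add: deg0_module_def deg0_ring_def self_module_carrier_update)

lemma ideal_prod_carrier_update [simp]: "ideal_prod (R\<lparr>carrier := K\<rparr>) I J = ideal_prod R I J"
  by (simp add: ideal_prod_eq_ideal_smult self_module_carrier_update)

context graded_ring
begin

lemma graded_module_self: "graded_module A gA (self_module A) gA"
proof -
  have "grading (self_module A) gA"
    using ring_grading unfolding grading_def by (auto intro: additive_subgroup_self_module)
  then show ?thesis
    by (intro graded_module.intro graded_ring_axioms self_module_module graded_module_axioms.intro)
      (simp_all add: ring_grading_mult)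
qed

lemma graded_ideal_iff_submodule:
  "graded_ideal A gA I \<longleftrightarrow> graded_submodule A (self_module A) gA I"
  unfolding graded_ideal_def graded_submodule_def ideal_iff_submodule by simp

lemma graded_ideal_hsum: "graded_ideal A gA I \<Longrightarrow> I \<subseteq> hsum A (\<lambda>i. gA i \<inter> I)"
  using graded_ideal_iff[OF graded_ring_axioms] by simp

lemma graded_ideal_ideal: "graded_ideal A gA I \<Longrightarrow> ideal I A"
  unfolding graded_ideal_def by simp

end

context graded_unit_ring
begin

lemma graded_unit_module_self: "graded_unit_module A gA tp (self_module A) gA"
  by (intro graded_unit_module.intro graded_unit_ring_axioms graded_module_self)

lemma deg0_ideal_iff:
  "ideal J (deg0_ring A gA) \<longleftrightarrow> submodule J (deg0_ring A gA) (deg0_module (self_module A) gA)"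
  unfolding deg0_self_module by (rule cring.ideal_iff_submodule[OF deg0_cring])

lemma graded_ideal_deg0: "graded_ideal A gA I \<Longrightarrow> ideal (I \<inter> gA 0) (deg0_ring A gA)"
  unfolding deg0_ideal_iff graded_ideal_iff_submodule
  by (rule graded_unit_module.graded_submodule_deg0(1)[OF graded_unit_module_self])

text \<open>The two claims are proved together: computing the next degree-zero part requires the
  current power to be graded, and the next power is graded because it is the extension of a
  degree-zero ideal.\<close>

lemma graded_ideal_pow:
  assumes I: "graded_ideal A gA I"
  shows "graded_ideal A gA (I [^]\<^bsub>ideals_set A\<^esub> (n::nat)) \<and>
    (I [^]\<^bsub>ideals_set A\<^esub> n) \<inter> gA 0 = (I \<inter> gA 0) [^]\<^bsub>ideals_set (deg0_ring A gA)\<^esub> n"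
proof (induction n)
  interpret s: graded_unit_module A gA tp "self_module A" gA by (rule graded_unit_module_self)
  {
    case 0
    have "graded_ideal A gA (carrier A)"
      unfolding graded_ideal_iff_submodule using s.graded_submodule_carrier by simp
    moreover have "gA 0 \<subseteq> carrier A" by (rule graded_group.gr_subset[OF graded_group])
    ultimately show ?case by (auto simp: nat_pow_def ideals_set_def deg0_ring_def)
  next
    case (Suc n)
    let ?J = "I [^]\<^bsub>ideals_set A\<^esub> n" and ?I0 = "I \<inter> gA 0"
    let ?K = "?I0 [^]\<^bsub>ideals_set (deg0_ring A gA)\<^esub> n"
    have J: "graded_ideal A gA ?J" and J0: "?J \<inter> gA 0 = ?K"
      using Suc by simp_all
    have I0: "ideal ?I0 (deg0_ring A gA)" by (rule graded_ideal_deg0[OF I])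
    have J0i: "ideal (?J \<inter> gA 0) (deg0_ring A gA)" by (rule graded_ideal_deg0[OF J])
    have sI: "submodule ?I0 (deg0_ring A gA) (deg0_module (self_module A) gA)"
      using I0 unfolding deg0_ideal_iff .
    have extI: "s.ext ?I0 = I"
      using s.graded_submodule_deg0(2) I unfolding graded_ideal_iff_submodule by simp
    \<comment> \<open>The power \<open>?J\<close> plays the ideal and \<open>?I0\<close> the
      submodule, whose extension is \<open>I\<close>.\<close>
    have eq: "s.ext (ideal_prod A (?J \<inter> gA 0) ?I0) = ideal_prod A ?J I"
      using s.ext_ideal_smult[OF graded_ideal_ideal[OF J] graded_ideal_hsum[OF J] J0i sI]
      unfolding extI ideal_prod_eq_ideal_smult .
    have "ideal (ideal_prod A (?J \<inter> gA 0) ?I0) (deg0_ring A gA)"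
      using ring.ideal_prod_is_ideal[OF cring.axioms(1)[OF deg0_cring] J0i I0]
      unfolding deg0_ring_def by simp
    then have sub: "submodule (ideal_prod A (?J \<inter> gA 0) ?I0) (deg0_ring A gA) (deg0_module (self_module A) gA)"
      unfolding deg0_ideal_iff .
    have "I [^]\<^bsub>ideals_set A\<^esub> Suc n = ideal_prod A ?J I"
      by (simp add: nat_pow_def ideals_set_def)
    moreover have "?I0 [^]\<^bsub>ideals_set (deg0_ring A gA)\<^esub> Suc n = ideal_prod A ?K ?I0"
      by (simp add: nat_pow_def ideals_set_def) (simp add: deg0_ring_def)
    ultimately show ?case
      using s.ext_graded_submodule[OF sub, unfolded eq] unfolding graded_ideal_iff_submodule J0 by simp
  }
qed

text \<open>A chain of ideals of the degree-zero ring extends to a chain of ideals of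
  \<open>A\<close>, which contains its union. Intersecting with degree zero returns the original
  ideals, so the member attaining the union contains all the others.\<close>

lemma noetherian_deg0:
  assumes "noetherian_ring A"
  shows "noetherian_ring (deg0_ring A gA)"
proof (rule ring.trivial_ideal_chain_imp_noetherian[OF cring.axioms(1)[OF deg0_cring]])
  interpret s: graded_unit_module A gA tp "self_module A" gA by (rule graded_unit_module_self)
  fix C assume C: "C \<noteq> {}" "subset.chain {I. ideal I (deg0_ring A gA)} C"
  have CI: "submodule J (deg0_ring A gA) (deg0_module (self_module A) gA)" if "J \<in> C" for J
    using C(2) that unfolding pred_on.chain_def deg0_ideal_iff by auto
  have cmp: "J \<subseteq> K \<or> K \<subseteq> J" if "J \<in> C" "K \<in> C" for J K
    using C(2) that unfolding pred_on.chain_def by auto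
  have "ideal (s.ext J) A" if "J \<in> C" for J
    by (rule graded_ideal_ideal)
      (use s.ext_graded_submodule(1)[OF CI[OF that]] graded_ideal_iff_submodule in simp)
  moreover have "s.ext J \<subseteq> s.ext K \<or> s.ext K \<subseteq> s.ext J" if "J \<in> C" "K \<in> C" for J K
    using cmp[OF that] s.ext_mono by metis
  ultimately have "subset.chain {I. ideal I A} (s.ext ` C)"
    unfolding pred_on.chain_def by auto
  then have "\<Union>(s.ext ` C) \<in> s.ext ` C"
    using noetherian_ring.ideal_chain_is_trivial[OF assms] C(1) by simp
  then obtain J where J: "J \<in> C" "\<Union>(s.ext ` C) = s.ext J" by auto
  have "K \<subseteq> J" if K: "K \<in> C" for K
  proof -
    have "s.ext K \<subseteq> s.ext J" using J(2) K by auto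
    then have "s.ext K \<inter> gA 0 \<subseteq> s.ext J \<inter> gA 0" by auto
    then show ?thesis
      unfolding s.ext_graded_submodule(2)[OF CI[OF K]] s.ext_graded_submodule(2)[OF CI[OF J(1)]] .
  qed
  then have "\<Union>C = J" using J(1) by auto
  then show "\<Union>C \<in> C" using J(1) by simp
qed

end

section \<open>Comparison of lengths and finiteness for all powers\<close>

context graded_unit_module
begin

text \<open>The case \<open>N = gM 0\<close> of \<open>ext_ideal_smult\<close>: since
  \<open>ext (gM 0)\<close> is all of \<open>M\<close>, the product \<open>J M\<close> is itself an
  extension, hence graded with the expected degree-zero part.\<close>

lemma ideal_smult_deg0:
  assumes J: "graded_ideal A gA J"
  shows "graded_submodule A M gM (ideal_smult M J)"
    and "ideal_smult M J \<inter> gM 0 = ideal_smult M0 (J \<inter> gA 0)"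
proof -
  have J0: "ideal (J \<inter> gA 0) A0" by (rule graded_ideal_deg0[OF J])
  have c: "carrier M \<inter> gM 0 = gM 0"
    using graded_group.gr_subset[OF module_graded_group, of 0] by auto
  have sub: "submodule (gM 0) A0 M0"
    using module.carrier_is_submodule[OF deg0_module] by (simp add: carrier_deg0)
  have "ext (gM 0) = carrier M"
    using graded_submodule_deg0(2)[OF graded_submodule_carrier] unfolding c .
  then have eq: "ext (ideal_smult M0 (J \<inter> gA 0)) = ideal_smult M J"
    using ext_ideal_smult[OF graded_ideal_ideal[OF J] graded_ideal_hsum[OF J] J0 sub]
    by (simp add: deg0_module_def)
  have "submodule (ideal_smult M0 (J \<inter> gA 0)) A0 M0"
    by (rule module.ideal_smult_carrier_submodule[OF deg0_module J0])
  from ext_graded_submodule[OF this]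
  show "graded_submodule A M gM (ideal_smult M J)"
    and "ideal_smult M J \<inter> gM 0 = ideal_smult M0 (J \<inter> gA 0)"
    unfolding eq .
qed

lemma star_length_eq_chain_length:
  assumes "graded_ideal A gA J"
  shows "star_length A (quot_module M (ideal_smult M J)) (quot_grading M gM (ideal_smult M J))
    = chain_length (\<lambda>K. submodule K A0 M0) (ideal_smult M0 (J \<inter> gA 0)) (carrier M0)"
proof -
  note J = ideal_smult_deg0[OF assms]
  have "pregraded_quotient A M gM (ideal_smult M J)"
    by (rule pregraded_quotient.intro[OF pregraded pregraded_quotient_axioms.intro[OF J(1)]])
  from pregraded_quotient.star_length_quot[OF this graded_submodule_carrier]
  show ?thesis unfolding chain_length_deg0[OF J(1)] J(2) carrier_deg0 .
qed

lemma mod_length_eq_chain_length: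
  assumes "ideal J A0"
  shows "mod_length A0 (quot_module M0 (ideal_smult M0 J))
    = chain_length (\<lambda>K. submodule K A0 M0) (ideal_smult M0 J) (carrier M0)"
  by (rule module.mod_length_quot[OF deg0_module
        module.ideal_smult_carrier_submodule[OF deg0_module assms]])

lemma star_length_eq_mod_length:
  assumes "graded_ideal A gA I"
  shows "star_length A (quot_module M (ideal_smult M (I [^]\<^bsub>ideals_set A\<^esub> (n::nat))))
      (quot_grading M gM (ideal_smult M (I [^]\<^bsub>ideals_set A\<^esub> n)))
    = mod_length A0 (quot_module M0 (ideal_smult M0 ((I \<inter> gA 0) [^]\<^bsub>ideals_set A0\<^esub> n)))"
proof -
  note p = graded_ideal_pow[OF assms, of n]
  have "ideal ((I \<inter> gA 0) [^]\<^bsub>ideals_set A0\<^esub> n) A0"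
    by (rule cring.ideal_pow_ideal[OF deg0_cring graded_ideal_deg0[OF assms]])
  from mod_length_eq_chain_length[OF this]
  show ?thesis using star_length_eq_chain_length[OF conjunct1[OF p]] p by simp
qed

text \<open>The condition on an ideal of definition is the case of exponent one; it is carried to
  degree zero first, and the passage to powers takes place over the Noetherian ring
  \<open>A0\<close>.\<close>

lemma mod_length_pow_finite:
  assumes noeth: "noetherian_ring A" and I: "graded_ideal_of_definition A gA M gM I"
  shows "mod_length A0 (quot_module M0 (ideal_smult M0 ((I \<inter> gA 0) [^]\<^bsub>ideals_set A0\<^esub> (n::nat)))) < \<infinity>"
proof -
  have gI: "graded_ideal A gA I" using I unfolding graded_ideal_of_definition_def by simp
  have I0: "ideal (I \<inter> gA 0) A0" by (rule graded_ideal_deg0[OF gI])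
  have "fin_len (\<lambda>K. submodule K A0 M0) (ideal_smult M0 (I \<inter> gA 0)) (carrier M0)"
    using I star_length_eq_chain_length[OF gI]
    unfolding graded_ideal_of_definition_def chain_length_finite_iff[symmetric] by simp
  then have "fin_len (\<lambda>K. submodule K A0 M0)
      (ideal_smult M0 ((I \<inter> gA 0) [^]\<^bsub>ideals_set A0\<^esub> n)) (carrier M0)"
    by (rule module.fin_len_ideal_pow[OF deg0_module noetherian_deg0[OF noeth] I0])
  then show ?thesis
    unfolding mod_length_eq_chain_length[OF cring.ideal_pow_ideal[OF deg0_cring I0]]
      chain_length_finite_iff .
qed

end

theorem theorem7p9:
  fixes A :: "('a, 'x) ring_scheme" and gA :: "int \<Rightarrow> 'a set" and P :: "'a set"
    and M :: "('a, 'b, 'y) module_scheme" and gM :: "int \<Rightarrow> 'b set" and I :: "'a set"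
  assumes "graded_ring A gA"
    and "noetherian_ring A"
    and "star_local A gA P"
    and "\<exists>t \<in> gA 1. t \<in> carrier A - P"
    and "graded_module A gA M gM"
    and "fin_gen_module A M"
    and "graded_ideal_of_definition A gA M gM I"
  shows "(\<forall>n::nat. mod_length (deg0_ring A gA)
            (quot_module (deg0_module M gM)
              (ideal_smult (deg0_module M gM)
                ((I \<inter> gA 0) [^]\<^bsub>ideals_set (deg0_ring A gA)\<^esub> n))) < \<infinity>) \<and>
         star_samuel_poly A M gM I
           = samuel_poly (deg0_ring A gA) (deg0_module M gM) (I \<inter> gA 0) \<and>
         (\<forall>d. degree (samuel_poly (deg0_ring A gA) (deg0_module M gM) (I \<inter> gA 0)) \<le> d \<and>
              degree (star_samuel_poly A M gM I) \<le> d \<longrightarrow>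
            multiplicity_at (deg0_ring A gA) (deg0_module M gM) (I \<inter> gA 0) d
              = star_multiplicity_at A M gM I d)"
proof -
  obtain t where t: "t \<in> gA 1" "t \<notin> P" using assms(4) by blast
  obtain s where s: "s \<in> gA (- 1)" "t \<otimes>\<^bsub>A\<^esub> s = \<one>\<^bsub>A\<^esub>"
    using graded_ring.star_local_homogeneous_unit[OF assms(1-3) t] by blast
  obtain tp where tp: "\<forall>i. tp i \<in> gA i" "\<forall>i j. tp i \<otimes>\<^bsub>A\<^esub> tp j = tp (i + j)" "tp 0 = \<one>\<^bsub>A\<^esub>"
    using graded_ring.homogeneous_powers[OF assms(1) t(1) s] by blast
  interpret graded_unit_module A gA tp M gM
    by (intro graded_unit_module.intro graded_unit_ring.intro assms graded_unit_ring_axioms.intro)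
      (use tp in auto)
  have I: "graded_ideal A gA I" using assms(7) unfolding graded_ideal_of_definition_def by simp
  \<comment> \<open>The two length functions coincide at every argument, so \<open>the_poly\<close>
    is applied to one and the same function.\<close>
  have poly: "star_samuel_poly A M gM I = samuel_poly A0 M0 (I \<inter> gA 0)"
    unfolding star_samuel_poly_def samuel_poly_def star_length_eq_mod_length[OF I] ..
  then show ?thesis
    using mod_length_pow_finite[OF assms(2,7)]
    unfolding multiplicity_at_def star_multiplicity_at_def by simp
qed

end
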